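(* Let $s\ge 2$ and let $M_1,\dots,M_s$ be invertible $d\times d$ matrices over $K$ whose columns are bases of lattices $\Lambda_1,\dots,\Lambda_s\subseteq K^d$. Let $L_s$ be the list of apartments of $\mathcal B_d$ returned by the apartment-list algorithm (described in the context) on input $M_1,\dots,M_s$. Then every lattice class $[\Lambda]\in\mathrm{conv}(\Lambda_1,\dots,\Lambda_s)$ is contained in some apartment $[A]\in L_s$. Furthermore, $L_s$ has size at most $(d!)^{s-2}$.
   Context: Setting: $K$ is a field with a discrete valuation $\mathrm{val}:K\to\mathbb Z\cup\{\infty\}$, $R$ is its valuation ring and $\pi$ a uniformizer. A lattice is an $R$-submodule of $K^d$ generated by $d$ linearly independent vectors; an invertible matrix represents the lattice generated over $R$ by its columns. Lattices $\Lambda_1,\Lambda_2$ are equivalent if $\Lambda_1=c\Lambda_2$ for some $c\in K^*$; $[\Lambda]$ is the class of $\Lambda$. These classes are the vertices of the affine building $\mathcal B_d$ of $SL_d(K)$. For an invertible $d\times d$ matrix $A$ with columns $v_1,\dots,v_d$, the apartment $[A]$ is the set of all classes of lattices $R\{\pi^{u_1}v_1,\dots,\pi^{u_d}v_d\}$ with $u_i\in\mathbb Z$. A set of lattice classes is convex if it is closed under taking intersections of finitely many representatives (any representatives of classes in the set). The convex hull $\mathrm{conv}$ of a (finite or infinite) collection of lattices or lattice classes is the smallest convex set of lattice classes containing their classes. SA-basis algorithm. Input: invertible $d\times d$ matrices $M_1,M_2$ over $K$. Set $B_1=M_1$, $C_1=M_2$. For $i=1,\dots,d-1$: let $N_i=B_i^{-1}C_i$;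 let the pivot $n_i$ be the entry of $N_i$ of minimal valuation among entries not in the positions of the earlier pivots $n_1,\dots,n_{i-1}$ (ties are broken by choosing the leftmost column, then the topmost row); let $L_i$ be the matrix such that $L_iN_i$ is obtained from $N_i$ by adding multiples of the row of $n_i$ to the other rows so as to eliminate all other entries in the column of $n_i$; let $R_i$ be the matrix such that $L_iN_iR_i$ is obtained from $L_iN_i$ by adding multiples of the column of $n_i$ to the other columns so as to eliminate all other entries in the row of $n_i$; set $B_{i+1}=B_iL_i^{-1}$, $C_{i+1}=C_iR_i$. Output $A=B_d$ and $\Delta=B_d^{-1}C_d$, which is a monomial matrix (its nonzero entries form the support of a permutation matrix). The $d$-th pivot is the one nonzero entry of $N_d=\Delta$ not in the position of an earlier pivot. The columns of $A$ and $A\Delta$ are bases of the lattices represented by $M_1$ and $M_2$; $A$ is called an SA-basis (simultaneously adaptable basis) for these lattices. Apartment-list algorithm. Input: $M_1,\dots,M_s$ with $s\ge2$. If $s=2$, return the single apartment $[A]$, where $A$ is the SA-basis output by the SA-basis algorithm on $(M_1,M_2)$. If $s\geq 3$, let $L_{s-1}$ be the list of apartments returned by this same algorithm on input $M_2,\dots,M_s$. For each $[A]\in L_{s-1}$, let $L_A$ be the set of apartments obtained as follows: for each permutation $\tau$ of $\{1,\dots,d\}$, choose a diagonal matrix $\Gamma=\mathrm{diag}(\pi^{a_1},\dots,\pi^{a_d})$, $a_j\in\mathbb Z$, such that in the SA-basis algorithm run on $(M_1,A\Gamma)$ the first, second, ..., $d$-th pivots lie in columns $\tau(1),\tau(2),\dots,\tau(d)$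 respectively (such $\Gamma$ exists), and put into $L_A$ the apartment $[B]$ of the resulting SA-basis $B$. Return $L_s=\bigcup_{[A]\in L_{s-1}}L_A$. *)

theory Defs
  imports
    "Jordan_Normal_Form.Gauss_Jordan_Elimination"
    "Jordan_Normal_Form.DL_Rank"
    "HOL-Library.Extended"
begin

section \<open>Discrete valuations\<close>

text \<open>Values lie in \<open>\<int> \<union> {\<infinity>}\<close>, i.e. in \<^typ>\<open>int extended\<close> without the bottom element \<^const>\<open>Minf\<close>.
  The image of the valuation on nonzero elements may be any nontrivial subgroup of the integers, so
  the normalised case (value 1 is attained) is included.\<close>

locale discrete_valuation =
  fixes val :: "'a :: field \<Rightarrow> int extended"
  assumes val_eq_Pinf_iff: "val x = Pinf \<longleftrightarrow> x = 0"
    and val_not_Minf: "val x \<noteq> Minf"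
    and val_mult: "val (x * y) = val x + val y"
    and val_add: "min (val x) (val y) \<le> val (x + y)"
    and val_nontrivial: "\<exists>x. x \<noteq> 0 \<and> val x \<noteq> 0"

definition val_ring :: "('a :: field \<Rightarrow> int extended) \<Rightarrow> 'a set" where
  "val_ring val = {x. 0 \<le> val x}"

text \<open>A generator of the maximal ideal of the valuation ring; for a normalised valuation this means
  value 1.\<close>

definition uniformizer :: "('a :: field \<Rightarrow> int extended) \<Rightarrow> 'a \<Rightarrow> bool" where
  "uniformizer val \<pi> \<longleftrightarrow> \<pi> \<noteq> 0 \<and> 0 < val \<pi> \<and> (\<forall>x. 0 < val x \<longrightarrow> val \<pi> \<le> val x)"


section \<open>Lattices, lattice classes, apartments and convex hulls\<close>

definition R_span :: "('a :: field \<Rightarrow> int extended) \<Rightarrow> nat \<Rightarrow> 'a vec list \<Rightarrow> 'a vec set" where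
  "R_span val d vs =
     {mat_of_cols d vs *\<^sub>v c | c. c \<in> carrier_vec (length vs) \<and> (\<forall>i < length vs. c $ i \<in> val_ring val)}"

definition is_lattice :: "('a :: field \<Rightarrow> int extended) \<Rightarrow> nat \<Rightarrow> 'a vec set \<Rightarrow> bool" where
  "is_lattice val d \<Lambda> \<longleftrightarrow>
     (\<exists>vs. length vs = d \<and> distinct vs \<and> set vs \<subseteq> carrier_vec d \<and>
        \<not> module.lin_dep class_ring (module_vec TYPE('a) d) (set vs) \<and> \<Lambda> = R_span val d vs)"

definition mat_lattice :: "('a :: field \<Rightarrow> int extended) \<Rightarrow> 'a mat \<Rightarrow> 'a vec set" where
  "mat_lattice val M = R_span val (dim_row M) (cols M)"

text \<open>The equivalence class of a lattice under scaling by nonzero elements of the field.\<close>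

definition homothety_class :: "'a :: field vec set \<Rightarrow> 'a vec set set" where
  "homothety_class \<Lambda> = {(\<lambda>v. c \<cdot>\<^sub>v v) ` \<Lambda> | c. c \<noteq> 0}"

definition building_vertices :: "('a :: field \<Rightarrow> int extended) \<Rightarrow> nat \<Rightarrow> 'a vec set set set" where
  "building_vertices val d = {homothety_class \<Lambda> | \<Lambda>. is_lattice val d \<Lambda>}"

definition apartment ::
  "('a :: field \<Rightarrow> int extended) \<Rightarrow> 'a \<Rightarrow> 'a mat \<Rightarrow> 'a vec set set set" where
  "apartment val \<pi> A =
     {homothety_class (R_span val (dim_row A) (map (\<lambda>i. (\<pi> powi u i) \<cdot>\<^sub>v col A i) [0..<dim_col A]))
      | u :: nat \<Rightarrow> int. True}"

text \<open>As \<open>T\<close> is a set of classes, the elements of \<open>\<Union> T\<close> are the representatives of classes in \<open>T\<close>.\<close>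

definition lattice_convex :: "('a :: field \<Rightarrow> int extended) \<Rightarrow> nat \<Rightarrow> 'a vec set set set \<Rightarrow> bool" where
  "lattice_convex val d T \<longleftrightarrow>
     T \<subseteq> building_vertices val d \<and>
     (\<forall>F. finite F \<longrightarrow> F \<noteq> {} \<longrightarrow> F \<subseteq> \<Union> T \<longrightarrow> homothety_class (\<Inter> F) \<in> T)"

definition lattice_conv ::
  "('a :: field \<Rightarrow> int extended) \<Rightarrow> nat \<Rightarrow> 'a vec set set set \<Rightarrow> 'a vec set set set" where
  "lattice_conv val d S = \<Inter> {T. lattice_convex val d T \<and> S \<subseteq> T}"


section \<open>The SA-basis algorithm\<close>

text \<open>Rows and columns are numbered from 0, and a matrix position is a pair (row, column).\<close>

definition mat_inv :: "'a :: field mat \<Rightarrow> 'a mat" where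
  "mat_inv A = the (mat_inverse A)"

definition is_pivot ::
  "('a :: field \<Rightarrow> int extended) \<Rightarrow> 'a mat \<Rightarrow> (nat \<times> nat) list \<Rightarrow> nat \<times> nat \<Rightarrow> bool" where
  "is_pivot val N ps = (\<lambda>(r, c).
     r < dim_row N \<and> c < dim_col N \<and> (r, c) \<notin> set ps \<and>
     (\<forall>i < dim_row N. \<forall>j < dim_col N. (i, j) \<notin> set ps \<longrightarrow>
        val (N $$ (r, c)) < val (N $$ (i, j)) \<or>
        val (N $$ (r, c)) = val (N $$ (i, j)) \<and> (c < j \<or> c = j \<and> r \<le> i)))"

definition sa_pivot ::
  "('a :: field \<Rightarrow> int extended) \<Rightarrow> 'a mat \<Rightarrow> (nat \<times> nat) list \<Rightarrow> nat \<times> nat" where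
  "sa_pivot val N ps = (THE p. is_pivot val N ps p)"

text \<open>Left multiplication by \<open>elim_left N (r, c)\<close> clears column \<open>c\<close> of \<open>N\<close> outside row \<open>r\<close>; right
  multiplication by \<open>elim_right N (r, c)\<close> clears row \<open>r\<close> outside column \<open>c\<close>.\<close>

definition elim_left :: "'a :: field mat \<Rightarrow> nat \<times> nat \<Rightarrow> 'a mat" where
  "elim_left N = (\<lambda>(r, c). mat (dim_row N) (dim_row N) (\<lambda>(i, j).
     if i = j then 1 else if j = r then - (N $$ (i, c) / N $$ (r, c)) else 0))"

definition elim_right :: "'a :: field mat \<Rightarrow> nat \<times> nat \<Rightarrow> 'a mat" where
  "elim_right N = (\<lambda>(r, c). mat (dim_col N) (dim_col N) (\<lambda>(i, j).
     if i = j then 1 else if i = c then - (N $$ (r, j) / N $$ (r, c)) else 0))"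

text \<open>A state consists of the two current matrices and the list of pivot positions found so far.\<close>

definition sa_step ::
  "('a :: field \<Rightarrow> int extended) \<Rightarrow> 'a mat \<times> 'a mat \<times> (nat \<times> nat) list
     \<Rightarrow> 'a mat \<times> 'a mat \<times> (nat \<times> nat) list" where
  "sa_step val = (\<lambda>(B, C, ps).
     let N = mat_inv B * C;
         p = sa_pivot val N ps;
         L = elim_left N p;
         R = elim_right (L * N) p
     in (B * mat_inv L, C * R, ps @ [p]))"

definition sa_final ::
  "('a :: field \<Rightarrow> int extended) \<Rightarrow> 'a mat \<Rightarrow> 'a mat \<Rightarrow> 'a mat \<times> 'a mat \<times> (nat \<times> nat) list" where
  "sa_final val M1 M2 = (sa_step val ^^ (dim_row M1 - 1)) (M1, M2, [])"

definition sa_basis :: "('a :: field \<Rightarrow> int extended) \<Rightarrow> 'a mat \<Rightarrow> 'a mat \<Rightarrow> 'a mat" where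
  "sa_basis val M1 M2 = (case sa_final val M1 M2 of (B, C, ps) \<Rightarrow> B)"

definition sa_Delta :: "('a :: field \<Rightarrow> int extended) \<Rightarrow> 'a mat \<Rightarrow> 'a mat \<Rightarrow> 'a mat" where
  "sa_Delta val M1 M2 = (case sa_final val M1 M2 of (B, C, ps) \<Rightarrow> mat_inv B * C)"

text \<open>The main loop only determines all pivots but the last one, which is read off from the final
  monomial matrix.\<close>

definition sa_pivots ::
  "('a :: field \<Rightarrow> int extended) \<Rightarrow> 'a mat \<Rightarrow> 'a mat \<Rightarrow> (nat \<times> nat) list" where
  "sa_pivots val M1 M2 = (case sa_final val M1 M2 of (B, C, ps) \<Rightarrow>
     let \<Delta> = sa_Delta val M1 M2
     in ps @ [THE p. fst p < dim_row \<Delta> \<and> snd p < dim_col \<Delta> \<and> p \<notin> set ps \<and> \<Delta> $$ p \<noteq> 0])"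


section \<open>The apartment-list algorithm\<close>

text \<open>Since the diagonal matrices are chosen freely, the algorithm is nondeterministic and is
  modelled as a relation between inputs and possible outputs. \<open>refines val \<pi> d M ap LA\<close> says that
  \<open>LA\<close> is a possible result of processing the single apartment \<open>ap\<close> against \<open>M\<close>; any
  invertible matrix \<open>A\<close> with apartment \<open>ap\<close> may be taken to represent it, and \<open>a \<tau>\<close> is the exponent
  vector chosen for the permutation \<open>\<tau>\<close>.\<close>

definition refines ::
  "('a :: field \<Rightarrow> int extended) \<Rightarrow> 'a \<Rightarrow> nat \<Rightarrow> 'a mat \<Rightarrow> 'a vec set set set
     \<Rightarrow> 'a vec set set set set \<Rightarrow> bool" where
  "refines val \<pi> d M ap LA \<longleftrightarrow>
     (\<exists>A (a :: (nat \<Rightarrow> nat) \<Rightarrow> nat \<Rightarrow> int).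
        A \<in> carrier_mat d d \<and> invertible_mat A \<and> apartment val \<pi> A = ap \<and>
        (\<forall>\<tau>. \<tau> permutes {..<d} \<longrightarrow>
           map snd (sa_pivots val M (A * mat_diag d (\<lambda>j. \<pi> powi a \<tau> j))) = map \<tau> [0..<d]) \<and>
        LA = {apartment val \<pi> (sa_basis val M (A * mat_diag d (\<lambda>j. \<pi> powi a \<tau> j)))
              | \<tau>. \<tau> permutes {..<d}})"

text \<open>\<open>apartment_list val \<pi> d Ms L\<close>: on input \<open>Ms\<close> the algorithm may return the collection \<open>L\<close> of
  apartments, each apartment being the set of its vertices.\<close>

inductive apartment_list ::
  "('a :: field \<Rightarrow> int extended) \<Rightarrow> 'a \<Rightarrow> nat \<Rightarrow> 'a mat list \<Rightarrow> 'a vec set set set set \<Rightarrow> bool"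
  for val \<pi> d where
  two: "apartment_list val \<pi> d [M1, M2] {apartment val \<pi> (sa_basis val M1 M2)}"
| more: "apartment_list val \<pi> d Ms L \<Longrightarrow> (\<And>ap. ap \<in> L \<Longrightarrow> refines val \<pi> d M ap (LA ap)) \<Longrightarrow>
    apartment_list val \<pi> d (M # Ms) (\<Union>ap \<in> L. LA ap)"

end

theory Submission
  imports Defs
begin

text \<open>Call a lattice adapted to \<open>B\<close> if it is spanned by multiples of the columns of \<open>B\<close>. Lattices
  adapted to \<open>B\<close> are closed under scaling and intersection, and both input lattices are adapted to the
  output of the SA-basis algorithm. Multiples of one lattice form a chain, so a lattice in the convex
  hull of \<open>\<Lambda>\<^sub>1, \<dots>, \<Lambda>\<^sub>s\<close> is a multiple of \<open>\<Lambda>\<^sub>1\<close>, or a lattice \<open>\<Lambda>'\<close> in the hull of the others, or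
  the intersection of two such lattices. By induction \<open>\<Lambda>'\<close> is spanned by the columns of \<open>A * D\<close> with
  \<open>D\<close> diagonal and \<open>[A]\<close> in the previous list. The SA-basis of \<open>(M\<^sub>1, A * D)\<close> depends on \<open>D\<close> only
  through the order of the pivot columns, so it is one of the \<open>d!\<close> bases that the algorithm lists
  for \<open>[A]\<close>, and its apartment contains the lattice.\<close>


section \<open>Valuations\<close>

text \<open>The algorithm is nondeterministic, so two things have to be shown separately: some
  output exists, and every output covers the hull. The second works for arbitrary choices of
  exponents because an SA-basis remembers nothing of the column scaling but the pivot order: the
  left elimination matrices consist of ratios within one column, in which the scalar of that column
  cancels, and only they enter the basis. The freedom in choosing a matrix for an apartment is
  harmless since adaptedness of a lattice depends on the apartment alone. The reduction to at most
  one multiple of the new lattice and one old lattice is decisive, as an SA-basis is adapted to two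
  lattices, not to several. That the elements of the hull are lattices at all is obtained from the
  covering itself: whatever is adapted to an invertible matrix is a lattice.\<close>

context discrete_valuation
begin

abbreviation \<O> :: "'a set" where "\<O> \<equiv> val_ring val"

lemma val_0 [simp]: "val 0 = Pinf"
  by (simp add: val_eq_Pinf_iff)

lemma val_FinE:
  assumes "x \<noteq> 0"
  obtains n where "val x = Fin n"
  using assms val_eq_Pinf_iff[of x] val_not_Minf[of x] by (cases "val x") auto

lemma val_1 [simp]: "val 1 = Fin 0"
proof -
  obtain n where n: "val 1 = Fin n" by (rule val_FinE[of 1]) auto
  with val_mult[of 1 1] show ?thesis by simp
qed

lemma val_minus [simp]: "val (- x) = val x"
proof -
  obtain n where n: "val (- 1) = Fin n" by (rule val_FinE[of "- 1"]) auto
  with val_mult[of "- 1" "- 1"] have "val (- 1) = Fin 0" by simp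
  with val_mult[of "- 1" x] show ?thesis by (simp flip: zero_extended_def)
qed

lemma val_inverse:
  assumes "x \<noteq> 0" "val x = Fin n"
  shows "val (inverse x) = Fin (- n)"
proof -
  obtain m where m: "val (inverse x) = Fin m"
    using assms by (auto intro: val_FinE[of "inverse x"])
  with val_mult[of x "inverse x"] assms show ?thesis by simp
qed

lemma val_power_int:
  assumes "x \<noteq> 0" "val x = Fin n"
  shows "val (x powi k) = Fin (k * n)"
proof -
  have *: "val (x ^ m) = Fin (int m * n)" for m
    by (induction m) (auto simp: val_mult assms algebra_simps)
  show ?thesis
  proof (cases "k \<ge> 0")
    case True
    then show ?thesis using *[of "nat k"] by (simp add: power_int_def)
  next
    case False
    then show ?thesis
      using val_inverse[OF _ *[of "nat (- k)"]] assms by (simp add: power_int_def power_inverse)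
  qed
qed

lemma zero_in_val_ring [simp]: "0 \<in> \<O>"
  and one_in_val_ring [simp]: "1 \<in> \<O>"
  by (auto simp: val_ring_def zero_extended_def)

lemma val_ring_minus [simp]: "- x \<in> \<O> \<longleftrightarrow> x \<in> \<O>"
  by (simp add: val_ring_def)

lemma val_ring_add [intro]: "x \<in> \<O> \<Longrightarrow> y \<in> \<O> \<Longrightarrow> x + y \<in> \<O>"
  using val_add[of x y] by (auto simp: val_ring_def min_def split: if_splits)

lemma val_ring_mult [intro]: "x \<in> \<O> \<Longrightarrow> y \<in> \<O> \<Longrightarrow> x * y \<in> \<O>"
  by (cases "val x"; cases "val y") (auto simp: val_ring_def val_mult zero_extended_def)

lemma val_ring_sum [intro]: "(\<And>i. i \<in> I \<Longrightarrow> f i \<in> \<O>) \<Longrightarrow> sum f I \<in> \<O>"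
  by (induction I rule: infinite_finite_induct) auto

text \<open>Turns comparisons of valuations into integrality of a quotient; the elimination
  multipliers are such quotients.\<close>

lemma val_le_iff_divide:
  assumes "x \<noteq> 0"
  shows "val x \<le> val y \<longleftrightarrow> y / x \<in> \<O>"
proof (cases "y = 0")
  case False
  obtain m n where "val x = Fin m" "val (y / x) = Fin n"
    using assms False by (metis divide_eq_0_iff val_FinE)
  with val_mult[of x "y / x"] assms show ?thesis
    by (simp add: val_ring_def zero_extended_def)
qed auto

text \<open>Division with remainder in the value group: a nonzero remainder would be a positive
  value below that of \<open>\<pi>\<close>, against the minimality of a uniformizer.\<close>

lemma uniformizer_associate:
  assumes "uniformizer val \<pi>" "x \<noteq> 0"
  obtains n where "val (\<pi> powi n) = val x"
proof -
  have \<pi>: "\<pi> \<noteq> 0" "0 < val \<pi>" "\<And>x. 0 < val x \<Longrightarrow> val \<pi> \<le> val x"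
    using assms by (auto simp: uniformizer_def)
  obtain p where p: "val \<pi> = Fin p" using \<pi>(1) by (rule val_FinE)
  with \<pi> have "p > 0" by (simp add: zero_extended_def)
  obtain m where m: "val x = Fin m" using assms(2) by (rule val_FinE)
  have *: "val (x * \<pi> powi (- (m div p))) = Fin (m mod p)"
    using m val_power_int[OF \<pi>(1) p, of "- (m div p)"]
    by (simp add: val_mult algebra_simps minus_div_mult_eq_mod minus_mult_div_eq_mod)
  have "m mod p = 0"
  proof (rule ccontr)
    assume "m mod p \<noteq> 0"
    with \<open>p > 0\<close> have "m mod p > 0" by (simp add: order_less_le)
    with \<pi>(3)[of "x * \<pi> powi (- (m div p))"] p have "p \<le> m mod p"
      by (simp add: * zero_extended_def)
    with pos_mod_bound[OF \<open>p > 0\<close>, of m] show False by simp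
  qed
  then have "val (\<pi> powi (m div p)) = val x"
    using m val_power_int[OF \<pi>(1) p, of "m div p"] by (metis add.right_neutral div_mult_mod_eq)
  then show ?thesis by (rule that)
qed

end


section \<open>Lattices\<close>

lemma invertible_matI:
  fixes A :: "'a :: field mat"
  assumes "A \<in> carrier_mat d d" "B \<in> carrier_mat d d" "A * B = 1\<^sub>m d"
  shows "invertible_mat A"
  using assms mat_mult_left_right_inverse[OF assms]
  by (auto simp: invertible_mat_def inverts_mat_def)

lemma mat_inv:
  fixes A :: "'a :: field mat"
  assumes "A \<in> carrier_mat d d" "invertible_mat A"
  shows "mat_inv A \<in> carrier_mat d d" "A * mat_inv A = 1\<^sub>m d" "mat_inv A * A = 1\<^sub>m d"
proof -
  obtain B where B: "A * B = 1\<^sub>m d" "B * A = 1\<^sub>m (dim_row B)"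
    using assms by (auto simp: invertible_mat_def inverts_mat_def)
  then have "B \<in> carrier_mat d d"
    by (metis assms(1) carrier_matD(2) carrier_matI index_mult_mat(2,3) index_one_mat(2,3))
  with B assms(1) have "A \<in> Units (ring_mat TYPE('a) d ())"
    by (auto simp: Units_def ring_mat_def)
  then have "mat_inverse A \<noteq> None"
    using mat_inverse(1)[OF assms(1), of "()"] by blast
  then obtain C where C: "mat_inverse A = Some C" by blast
  show "mat_inv A \<in> carrier_mat d d" "A * mat_inv A = 1\<^sub>m d" "mat_inv A * A = 1\<^sub>m d"
    using mat_inverse(2)[OF assms(1) C] C by (auto simp: mat_inv_def)
qed

lemma mat_inv_unique:
  fixes A :: "'a :: field mat"
  assumes "A \<in> carrier_mat d d" "B \<in> carrier_mat d d" "A * B = 1\<^sub>m d"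
  shows "mat_inv A = B"
proof -
  note inv = mat_inv[OF assms(1) invertible_matI[OF assms]]
  have "mat_inv A = mat_inv A * (A * B)" using inv assms by simp
  also have "\<dots> = (mat_inv A * A) * B"
    by (rule assoc_mult_mat[symmetric]) (use inv assms in auto)
  finally show ?thesis using inv assms by simp
qed

lemma mat_inv_mat_inv:
  fixes A :: "'a :: field mat"
  assumes "A \<in> carrier_mat d d" "invertible_mat A"
  shows "mat_inv (mat_inv A) = A" "invertible_mat (mat_inv A)"
  using mat_inv[OF assms] assms by (auto intro: mat_inv_unique invertible_matI)

lemma mat_inv_mult:
  fixes A B :: "'a :: field mat"
  assumes "A \<in> carrier_mat d d" "invertible_mat A" "B \<in> carrier_mat d d" "invertible_mat B"
  shows "mat_inv (A * B) = mat_inv B * mat_inv A" "invertible_mat (A * B)"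
proof -
  note A = mat_inv[OF assms(1,2)] and B = mat_inv[OF assms(3,4)]
  have "A * B * (mat_inv B * mat_inv A) = A * (B * (mat_inv B * mat_inv A))"
    using A B assms by (simp add: assoc_mult_mat[of _ d d _ d _ d])
  also have "B * (mat_inv B * mat_inv A) = B * mat_inv B * mat_inv A"
    by (rule assoc_mult_mat[symmetric]) (use A B assms in auto)
  finally have "A * B * (mat_inv B * mat_inv A) = 1\<^sub>m d"
    using A(1) left_mult_one_mat[OF A(1)] by (simp only: A(2) B(2))
  then show "mat_inv (A * B) = mat_inv B * mat_inv A" "invertible_mat (A * B)"
    using A B assms
    by (auto intro: mat_inv_unique[of _ d] invertible_matI[of _ d "mat_inv B * mat_inv A"])
qed

lemma mat_diag_inverse:
  fixes f :: "nat \<Rightarrow> 'a :: field"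
  assumes "\<And>i. i < d \<Longrightarrow> f i \<noteq> 0"
  shows "mat_inv (mat_diag d f) = mat_diag d (\<lambda>i. inverse (f i))" "invertible_mat (mat_diag d f)"
proof -
  have "mat_diag d f * mat_diag d (\<lambda>i. inverse (f i)) = 1\<^sub>m d"
    using assms by (simp, auto simp: mat_diag_def intro!: eq_matI)
  then show "mat_inv (mat_diag d f) = mat_diag d (\<lambda>i. inverse (f i))" "invertible_mat (mat_diag d f)"
    by (auto intro: mat_inv_unique[of _ d] invertible_matI[of _ d "mat_diag d (\<lambda>i. inverse (f i))"])
qed

section \<open>Lattices of matrices, adapted bases and apartments\<close>

context discrete_valuation
begin

definition integral_vecs :: "nat \<Rightarrow> 'a vec set" where
  "integral_vecs d = {c \<in> carrier_vec d. \<forall>i < d. c $ i \<in> \<O>}"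

definition integral_mats :: "nat \<Rightarrow> 'a mat set" where
  "integral_mats d = {U \<in> carrier_mat d d. \<forall>i < d. \<forall>j < d. U $$ (i, j) \<in> \<O>}"

lemma mat_lattice_eq_image:
  assumes "M \<in> carrier_mat d d"
  shows "mat_lattice val M = (*\<^sub>v) M ` integral_vecs d"
proof -
  have "mat_of_cols d (cols M) = M" using assms by (metis carrier_matD(1) mat_of_cols_cols)
  then show ?thesis
    using assms by (auto simp: mat_lattice_def R_span_def integral_vecs_def)
qed

lemma mult_integral:
  assumes "U \<in> integral_mats d" "c \<in> integral_vecs d"
  shows "U *\<^sub>v c \<in> integral_vecs d"
  using assms by (auto simp: integral_mats_def integral_vecs_def scalar_prod_def intro!: val_ring_sum val_ring_mult)

lemma mat_lattice_mult_subset: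
  assumes "M \<in> carrier_mat d d" "U \<in> integral_mats d"
  shows "mat_lattice val (M * U) \<subseteq> mat_lattice val M"
proof -
  have U: "U \<in> carrier_mat d d" using assms by (auto simp: integral_mats_def)
  have "M * U *\<^sub>v c = M *\<^sub>v (U *\<^sub>v c)" if "c \<in> integral_vecs d" for c
    using that U assms by (auto simp: integral_vecs_def)
  then show ?thesis
    using assms U mult_integral by (auto simp: mat_lattice_eq_image[of _ d])
qed

text \<open>Change of basis by an element of \<open>GL_d(\<O>)\<close>; the integral inverse
  \<open>V\<close> takes the place of a condition on the determinant.\<close>

lemma mat_lattice_mult_unimodular:
  assumes "M \<in> carrier_mat d d" "U \<in> integral_mats d" "V \<in> integral_mats d" "U * V = 1\<^sub>m d"
  shows "mat_lattice val (M * U) = mat_lattice val M"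
proof
  have UV: "U \<in> carrier_mat d d" "V \<in> carrier_mat d d" using assms by (auto simp: integral_mats_def)
  have "M * U * V = M" using UV assms by (simp add: assoc_mult_mat[of _ d d _ d _ d])
  with mat_lattice_mult_subset[of "M * U" d V] UV assms
  show "mat_lattice val M \<subseteq> mat_lattice val (M * U)" by auto
qed (use assms mat_lattice_mult_subset in auto)

text \<open>The scalars are arbitrary rather than powers of a uniformizer, so that multiples of a
  lattice and the entries of a monomial matrix fit in directly.\<close>

definition adapted :: "nat \<Rightarrow> 'a mat \<Rightarrow> 'a vec set \<Rightarrow> bool" where
  "adapted d A \<Lambda> \<longleftrightarrow> (\<exists>f. (\<forall>i < d. f i \<noteq> 0) \<and> \<Lambda> = mat_lattice val (A * mat_diag d f))"

text \<open>In coordinates with respect to \<open>A\<close> the lattice is a product of fractional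
  ideals \<open>f i * \<O>\<close>, so equalities and intersections can be checked coordinate by
  coordinate.\<close>

lemma mem_diag_lattice:
  assumes A: "A \<in> carrier_mat d d" "invertible_mat A" and f: "\<And>i. i < d \<Longrightarrow> f i \<noteq> 0"
  shows "v \<in> mat_lattice val (A * mat_diag d f) \<longleftrightarrow>
    v \<in> carrier_vec d \<and> (\<forall>i < d. (mat_inv A *\<^sub>v v) $ i / f i \<in> \<O>)"
proof -
  note inv = mat_inv[OF A]
  have D: "mat_diag d f *\<^sub>v c = vec d (\<lambda>i. f i * c $ i)" if "c \<in> carrier_vec d" for c
    using that by (auto simp: mat_diag_def scalar_prod_def intro!: eq_vecI)
      (simp add: if_distrib[of "\<lambda>x. x * _"] sum.delta cong: if_cong)
  have AD: "A * mat_diag d f *\<^sub>v c = A *\<^sub>v vec d (\<lambda>i. f i * c $ i)" if "c \<in> carrier_vec d" for c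
    using that A by (simp add: D assoc_mult_mat_vec[of _ d d _ d])
  have AA: "A *\<^sub>v (mat_inv A *\<^sub>v v) = v" if "v \<in> carrier_vec d" for v
    using that A inv by (simp flip: assoc_mult_mat_vec[of _ d d _ d])
  have AA': "mat_inv A *\<^sub>v (A *\<^sub>v v) = v" if "v \<in> carrier_vec d" for v
    using that A inv by (simp flip: assoc_mult_mat_vec[of _ d d _ d])
  show ?thesis
  proof
    assume "v \<in> mat_lattice val (A * mat_diag d f)"
    then obtain c where c: "c \<in> integral_vecs d" "v = A *\<^sub>v vec d (\<lambda>i. f i * c $ i)"
      using A AD by (auto simp: mat_lattice_eq_image[of _ d] integral_vecs_def)
    with A f show "v \<in> carrier_vec d \<and> (\<forall>i < d. (mat_inv A *\<^sub>v v) $ i / f i \<in> \<O>)"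
      by (auto simp: AA' integral_vecs_def)
  next
    assume v: "v \<in> carrier_vec d \<and> (\<forall>i < d. (mat_inv A *\<^sub>v v) $ i / f i \<in> \<O>)"
    define c where "c = vec d (\<lambda>i. (mat_inv A *\<^sub>v v) $ i / f i)"
    have c: "c \<in> integral_vecs d" using v by (auto simp: integral_vecs_def c_def)
    have "vec d (\<lambda>i. f i * c $ i) = mat_inv A *\<^sub>v v"
      using f inv by (auto simp: c_def intro!: eq_vecI)
    then have "A * mat_diag d f *\<^sub>v c = v"
      using v c AA by (auto simp: AD integral_vecs_def)
    then show "v \<in> mat_lattice val (A * mat_diag d f)"
      using A c by (force simp: mat_lattice_eq_image[of _ d])
  qed
qed

lemma diag_lattice_cong:
  assumes "A \<in> carrier_mat d d" "invertible_mat A"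
    and "\<And>i. i < d \<Longrightarrow> f i \<noteq> 0" "\<And>i. i < d \<Longrightarrow> val (f i) = val (g i)"
  shows "mat_lattice val (A * mat_diag d f) = mat_lattice val (A * mat_diag d g)"
proof -
  have g: "g i \<noteq> 0" if "i < d" for i
    using assms(3,4)[OF that] val_eq_Pinf_iff by metis
  have "x / f i \<in> \<O> \<longleftrightarrow> x / g i \<in> \<O>" if "i < d" for i x
    using assms(3,4)[OF that] g[OF that] by (simp flip: val_le_iff_divide)
  then show ?thesis
    using assms g by (auto simp: mem_diag_lattice)
qed

lemma adapted_Int:
  assumes A: "A \<in> carrier_mat d d" "invertible_mat A" and "adapted d A \<Lambda>" "adapted d A \<Lambda>'"
  shows "adapted d A (\<Lambda> \<inter> \<Lambda>')"
proof -
  obtain f g where f: "\<And>i. i < d \<Longrightarrow> f i \<noteq> 0" "\<Lambda> = mat_lattice val (A * mat_diag d f)"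
    and g: "\<And>i. i < d \<Longrightarrow> g i \<noteq> 0" "\<Lambda>' = mat_lattice val (A * mat_diag d g)"
    using assms by (auto simp: adapted_def)
  \<comment> \<open>Fractional ideals form a chain, so in each coordinate the intersection is
    generated by the scalar of larger valuation.\<close>
  define h where "h i = (if val (f i) \<le> val (g i) then g i else f i)" for i
  have h: "h i \<noteq> 0" if "i < d" for i using f g that by (simp add: h_def)
  have "x / h i \<in> \<O> \<longleftrightarrow> x / f i \<in> \<O> \<and> x / g i \<in> \<O>" if "i < d" for x i
    using f(1) g(1) h that by (auto simp: h_def simp flip: val_le_iff_divide)
  then have "\<Lambda> \<inter> \<Lambda>' = mat_lattice val (A * mat_diag d h)"
    using A f g h by (auto simp: mem_diag_lattice)
  with h show ?thesis by (auto simp: adapted_def)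
qed

lemma adapted_smult:
  assumes A: "A \<in> carrier_mat d d" and "adapted d A \<Lambda>" "c \<noteq> 0"
  shows "adapted d A ((\<cdot>\<^sub>v) c ` \<Lambda>)"
proof -
  obtain f where f: "\<And>i. i < d \<Longrightarrow> f i \<noteq> 0" "\<Lambda> = mat_lattice val (A * mat_diag d f)"
    using assms by (auto simp: adapted_def)
  have *: "A * mat_diag d (\<lambda>i. c * f i) = c \<cdot>\<^sub>m (A * mat_diag d f)"
    using A by (auto simp: mat_diag_mult_right[of _ d] intro!: eq_matI)
  have cM: "c \<cdot>\<^sub>m M *\<^sub>v x = c \<cdot>\<^sub>v (M *\<^sub>v x)" if "M \<in> carrier_mat d d" "x \<in> carrier_vec d" for M x
    using that by (auto simp: scalar_prod_def sum_distrib_left mult.assoc intro!: eq_vecI)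
  have "(\<cdot>\<^sub>v) c ` \<Lambda> = mat_lattice val (A * mat_diag d (\<lambda>i. c * f i))"
    unfolding f(2) * using A
    by (subst (1 2) mat_lattice_eq_image[of _ d])
       (auto simp: image_image integral_vecs_def cM intro!: image_cong)
  with f(1) assms(3) show ?thesis
    by (auto simp: adapted_def intro!: exI[of _ "\<lambda>i. c * f i"])
qed

lemma adapted_self: "A \<in> carrier_mat d d \<Longrightarrow> adapted d A (mat_lattice val A)"
  unfolding adapted_def by (rule exI[of _ "\<lambda>_. 1"]) simp

lemma mat_lattice_is_lattice:
  assumes "M \<in> carrier_mat d d" "invertible_mat M"
  shows "is_lattice val d (mat_lattice val M)"
proof -
  interpret vec_space "TYPE('a)" d .
  have "det M \<noteq> 0"
  proof
    assume "det M = 0"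
    then have "det (M * mat_inv M) = 0"
      using det_mult[OF assms(1) mat_inv(1)[OF assms]] by simp
    then show False unfolding mat_inv(2)[OF assms] by simp
  qed
  moreover have "distinct (cols M)"
    using \<open>det M \<noteq> 0\<close> non_distinct_low_rank[OF assms(1)] det_rank_iff[OF assms(1)] by auto
  moreover have "lin_indpt (set (cols M))"
    using \<open>det M \<noteq> 0\<close> lin_dep_cols_imp_det_0[OF assms(1)] by blast
  ultimately show ?thesis
    using assms cols_dim[of M] unfolding is_lattice_def mat_lattice_def
    by (intro exI[of _ "cols M"]) auto
qed

lemma adapted_is_lattice:
  assumes "A \<in> carrier_mat d d" "invertible_mat A" "adapted d A \<Lambda>"
  shows "is_lattice val d \<Lambda>"
proof -
  obtain f where f: "\<And>i. i < d \<Longrightarrow> f i \<noteq> 0" "\<Lambda> = mat_lattice val (A * mat_diag d f)"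
    using assms by (auto simp: adapted_def)
  have "invertible_mat (A * mat_diag d f)"
    using assms f(1) by (intro mat_inv_mult(2)[of _ d] mat_diag_inverse(2)) auto
  then show ?thesis
    unfolding f(2) using assms by (intro mat_lattice_is_lattice) auto
qed

lemma apartment_eq:
  assumes "A \<in> carrier_mat d d"
  shows "apartment val \<pi> A =
    {homothety_class (mat_lattice val (A * mat_diag d (\<lambda>i. \<pi> powi u i))) | u. True}"
proof -
  have "map (\<lambda>i. (\<pi> powi u i) \<cdot>\<^sub>v col A i) [0..<d] = cols (A * mat_diag d (\<lambda>i. \<pi> powi u i))" for u
    using assms by (auto simp: mat_diag_mult_right[of _ d] cols_def intro!: eq_vecI)
  then show ?thesis
    using assms by (simp add: apartment_def mat_lattice_def)
qed

lemma smult_self_homothety_class: "\<Lambda> \<in> homothety_class \<Lambda>"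
proof -
  have "\<Lambda> = (\<lambda>v. 1 \<cdot>\<^sub>v v) ` \<Lambda>" by simp
  then show ?thesis
    unfolding homothety_class_def mem_Collect_eq by (intro exI[of _ 1]) simp
qed

text \<open>Shows that adaptedness depends only on the apartment and on the class of the lattice,
  hence not on the matrix that represents the apartment.\<close>

lemma adapted_iff_apartment:
  assumes A: "A \<in> carrier_mat d d" "invertible_mat A" and \<pi>: "uniformizer val \<pi>"
  shows "adapted d A \<Lambda> \<longleftrightarrow> homothety_class \<Lambda> \<in> apartment val \<pi> A"
proof
  assume "adapted d A \<Lambda>"
  then obtain f where f: "\<And>i. i < d \<Longrightarrow> f i \<noteq> 0" "\<Lambda> = mat_lattice val (A * mat_diag d f)"
    by (auto simp: adapted_def)
  have "\<exists>n. i < d \<longrightarrow> val (f i) = val (\<pi> powi n)" for i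
    using uniformizer_associate[OF \<pi> f(1)] by metis
  then obtain u where "\<And>i. i < d \<Longrightarrow> val (f i) = val (\<pi> powi u i)" by metis
  then have "\<Lambda> = mat_lattice val (A * mat_diag d (\<lambda>i. \<pi> powi u i))"
    unfolding f(2) using A f(1) by (intro diag_lattice_cong) auto
  then show "homothety_class \<Lambda> \<in> apartment val \<pi> A"
    using A by (auto simp: apartment_eq)
next
  assume "homothety_class \<Lambda> \<in> apartment val \<pi> A"
  then obtain u where
    "homothety_class \<Lambda> = homothety_class (mat_lattice val (A * mat_diag d (\<lambda>i. \<pi> powi u i)))"
    using A by (auto simp: apartment_eq)
  then have "\<Lambda> \<in> homothety_class (mat_lattice val (A * mat_diag d (\<lambda>i. \<pi> powi u i)))"
    using smult_self_homothety_class by metis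
  then obtain c where c: "c \<noteq> 0"
    "\<Lambda> = (\<cdot>\<^sub>v) c ` mat_lattice val (A * mat_diag d (\<lambda>i. \<pi> powi u i))"
    by (auto simp: homothety_class_def)
  have "adapted d A (mat_lattice val (A * mat_diag d (\<lambda>i. \<pi> powi u i)))"
    unfolding adapted_def
    by (rule exI[of _ "\<lambda>i. \<pi> powi u i"]) (use \<pi> in \<open>auto simp: uniformizer_def\<close>)
  with c A show "adapted d A \<Lambda>" by (auto intro: adapted_smult)
qed

end


section \<open>Elimination steps\<close>

text \<open>As a left factor this adds \<open>v i\<close> times row \<open>r\<close> to row
  \<open>i\<close>; \<open>row_shear\<close> is the mirror image for columns. The value
  \<open>v r\<close> is ignored, so negating \<open>v\<close> gives the inverse, and elimination
  multipliers fit without a case distinction at the pivot row.\<close>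

definition col_shear :: "nat \<Rightarrow> nat \<Rightarrow> (nat \<Rightarrow> 'a :: field) \<Rightarrow> 'a mat" where
  "col_shear d r v = mat d d (\<lambda>(i, j). if i = j then 1 else if j = r then v i else 0)"

definition row_shear :: "nat \<Rightarrow> nat \<Rightarrow> (nat \<Rightarrow> 'a :: field) \<Rightarrow> 'a mat" where
  "row_shear d c w = mat d d (\<lambda>(i, j). if i = j then 1 else if i = c then w j else 0)"

lemma shear_carrier [simp]:
  "col_shear d r v \<in> carrier_mat d d" "row_shear d c w \<in> carrier_mat d d"
  by (simp_all add: col_shear_def row_shear_def)

lemma index_col_shear_mult:
  assumes "A \<in> carrier_mat d d" "r < d" "i < d" "j < d"
  shows "(col_shear d r v * A) $$ (i, j) = A $$ (i, j) + (if i = r then 0 else v i * A $$ (r, j))"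
proof -
  have "(col_shear d r v * A) $$ (i, j) =
      (\<Sum>k<d. (if i = k then 1 else if k = r then v i else 0) * A $$ (k, j))"
    using assms by (auto simp: col_shear_def scalar_prod_def atLeast0LessThan intro!: sum.cong)
  also have "\<dots> = (\<Sum>k<d. (if i = k then A $$ (k, j) else 0) +
      (if r = k then (if i = r then 0 else v i * A $$ (k, j)) else 0))"
    by (intro sum.cong) auto
  finally show ?thesis using assms by (simp add: sum.distrib)
qed

lemma index_mult_row_shear:
  assumes "A \<in> carrier_mat d d" "c < d" "i < d" "j < d"
  shows "(A * row_shear d c w) $$ (i, j) = A $$ (i, j) + (if j = c then 0 else A $$ (i, c) * w j)"
proof -
  have "(A * row_shear d c w) $$ (i, j) =
      (\<Sum>k<d. A $$ (i, k) * (if k = j then 1 else if k = c then w j else 0))"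
    using assms by (auto simp: row_shear_def scalar_prod_def atLeast0LessThan intro!: sum.cong)
  also have "\<dots> = (\<Sum>k<d. (if j = k then A $$ (i, k) else 0) +
      (if c = k then (if j = c then 0 else A $$ (i, k) * w j) else 0))"
    by (intro sum.cong) auto
  finally show ?thesis using assms by (simp add: sum.distrib)
qed

lemma col_shear_inverse:
  assumes "r < d"
  shows "col_shear d r v * col_shear d r (\<lambda>i. - v i) = 1\<^sub>m d"
  by (intro eq_matI)
     (auto simp: index_col_shear_mult[OF _ assms] simp del: index_mult_mat(1),
      auto simp: col_shear_def assms)

lemma row_shear_inverse:
  assumes "c < d"
  shows "row_shear d c w * row_shear d c (\<lambda>i. - w i) = 1\<^sub>m d"
  by (intro eq_matI)
     (auto simp: index_mult_row_shear[OF _ assms] simp del: index_mult_mat(1),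
      auto simp: row_shear_def assms)

lemma elim_left_eq:
  "N \<in> carrier_mat d d \<Longrightarrow> elim_left N (r, c) = col_shear d r (\<lambda>i. - (N $$ (i, c) / N $$ (r, c)))"
  by (simp add: elim_left_def col_shear_def)

lemma elim_right_eq:
  "N \<in> carrier_mat d d \<Longrightarrow> elim_right N (r, c) = row_shear d c (\<lambda>j. - (N $$ (r, j) / N $$ (r, c)))"
  by (simp add: elim_right_def row_shear_def)

text \<open>Off the pivot row and column this is the Schur complement. The right factor is computed
  from \<open>elim_left N (r, c) * N\<close>, but that matrix has the same row \<open>r\<close> as
  \<open>N\<close>, so only entries of \<open>N\<close> appear.\<close>

lemma index_eliminate:
  fixes N :: "'a :: field mat"
  assumes N: "N \<in> carrier_mat d d" and p: "r < d" "c < d" "N $$ (r, c) \<noteq> 0" and ij: "i < d" "j < d"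
  shows "(elim_left N (r, c) * N * elim_right (elim_left N (r, c) * N) (r, c)) $$ (i, j) =
    (if i = r \<and> j = c then N $$ (r, c) else if i = r \<or> j = c then 0
     else N $$ (i, j) - N $$ (i, c) * N $$ (r, j) / N $$ (r, c))"
proof -
  let ?N' = "elim_left N (r, c) * N"
  have c: "?N' \<in> carrier_mat d d"
    unfolding elim_left_eq[OF N] by (rule mult_carrier_mat[OF shear_carrier(1) N])
  have N': "?N' $$ (i, j) = (if i = r then N $$ (r, j) else
      N $$ (i, j) - N $$ (i, c) * N $$ (r, j) / N $$ (r, c))" if "i < d" "j < d" for i j
    using that p(1) unfolding elim_left_eq[OF N] by (subst index_col_shear_mult[OF N]) auto
  have "(?N' * elim_right ?N' (r, c)) $$ (i, j) =
      ?N' $$ (i, j) + (if j = c then 0 else ?N' $$ (i, c) * - (?N' $$ (r, j) / ?N' $$ (r, c)))"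
    unfolding elim_right_eq[OF c] using c p ij by (intro index_mult_row_shear)
  also have "\<dots> = (if i = r \<and> j = c then N $$ (r, c) else if i = r \<or> j = c then 0
     else N $$ (i, j) - N $$ (i, c) * N $$ (r, j) / N $$ (r, c))"
    using p ij by (simp add: N' field_simps)
  finally show ?thesis .
qed

text \<open>Separated from the choice of the pivot, the step serves the actual run and the run with
  prescribed columns alike.\<close>

definition elim_step ::
  "nat \<times> nat \<Rightarrow> 'a :: field mat \<times> 'a mat \<times> (nat \<times> nat) list \<Rightarrow> 'a mat \<times> 'a mat \<times> (nat \<times> nat) list" where
  "elim_step p = (\<lambda>(B, C, ps).
     let N = mat_inv B * C; L = elim_left N p; R = elim_right (L * N) p
     in (B * mat_inv L, C * R, ps @ [p]))"

lemma sa_step_eq: "sa_step val (B, C, ps) = elim_step (sa_pivot val (mat_inv B * C) ps) (B, C, ps)"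
  by (simp add: sa_step_def elim_step_def Let_def)

text \<open>Loop invariant on the way to a monomial matrix. The remaining entries of pivot rows and
  columns are zero, which is why the algorithm may exclude just the pivot positions and not their
  whole rows and columns.\<close>

definition cleared :: "nat \<Rightarrow> 'a :: field mat \<Rightarrow> (nat \<times> nat) list \<Rightarrow> bool" where
  "cleared d N ps \<longleftrightarrow> distinct (map fst ps) \<and> distinct (map snd ps) \<and>
     (\<forall>(r, c) \<in> set ps. r < d \<and> c < d \<and> N $$ (r, c) \<noteq> 0 \<and>
        (\<forall>i < d. i \<noteq> r \<longrightarrow> N $$ (i, c) = 0) \<and> (\<forall>j < d. j \<noteq> c \<longrightarrow> N $$ (r, j) = 0))"

lemma clearedD:
  assumes "cleared d N ps" "(r, c) \<in> set ps"
  shows "r < d" "c < d" "N $$ (r, c) \<noteq> 0" "i < d \<Longrightarrow> i \<noteq> r \<Longrightarrow> N $$ (i, c) = 0"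
    "j < d \<Longrightarrow> j \<noteq> c \<Longrightarrow> N $$ (r, j) = 0"
  using assms by (auto simp: cleared_def)

text \<open>Entries of a used row or column vanish off the pivots, so a nonzero entry elsewhere
  opens a new row and a new column.\<close>

lemma cleared_fresh:
  assumes "cleared d N ps" "r < d" "c < d" "(r, c) \<notin> set ps" "N $$ (r, c) \<noteq> 0"
  shows "r \<notin> fst ` set ps" "c \<notin> snd ` set ps"
proof -
  have "\<not> (r, c') \<in> set ps" for c'
    using assms clearedD[OF assms(1), of r c'] by metis
  then show "r \<notin> fst ` set ps" by auto
  have "\<not> (r', c) \<in> set ps" for r'
    using assms clearedD[OF assms(1), of r' c] by metis
  then show "c \<notin> snd ` set ps" by auto
qed

text \<open>Earlier pivots survive: their rows vanish in column \<open>c\<close> and their columns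
  vanish in row \<open>r\<close>, so the Schur correction is zero on them.\<close>

lemma cleared_eliminate:
  assumes N: "N \<in> carrier_mat d d"
    and p: "cleared d N ps" "r < d" "c < d" "(r, c) \<notin> set ps" "N $$ (r, c) \<noteq> 0"
  shows "cleared d (elim_left N (r, c) * N * elim_right (elim_left N (r, c) * N) (r, c)) (ps @ [(r, c)])"
proof -
  have fresh: "r' \<noteq> r" "c' \<noteq> c" if "(r', c') \<in> set ps" for r' c'
    using cleared_fresh[OF p] that by force+
  show ?thesis
    unfolding cleared_def
  proof (intro conjI ballI)
    show "distinct (map fst (ps @ [(r, c)]))" "distinct (map snd (ps @ [(r, c)]))"
      using cleared_fresh[OF p] p(1) by (auto simp: cleared_def)
  next
    fix q assume "q \<in> set (ps @ [(r, c)])"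
    then consider (new) "q = (r, c)" | (old) "q \<in> set ps" by auto
    then show "case q of (r', c') \<Rightarrow> r' < d \<and> c' < d \<and>
        (elim_left N (r, c) * N * elim_right (elim_left N (r, c) * N) (r, c)) $$ (r', c') \<noteq> 0 \<and>
        (\<forall>i < d. i \<noteq> r' \<longrightarrow> (elim_left N (r, c) * N * elim_right (elim_left N (r, c) * N) (r, c)) $$ (i, c') = 0) \<and>
        (\<forall>j < d. j \<noteq> c' \<longrightarrow> (elim_left N (r, c) * N * elim_right (elim_left N (r, c) * N) (r, c)) $$ (r', j) = 0)"
    proof cases
      case new
      then show ?thesis using p(2,3,5) by (simp add: index_eliminate[OF N] del: index_mult_mat)
    next
      case old
      obtain r' c' where q: "q = (r', c')" by force
      note D = clearedD[OF p(1) old[unfolded q]] and F = fresh[OF old[unfolded q]]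
      show ?thesis
        unfolding q prod.case using D(1-3) D(4)[of r] D(5)[of c] F p(2,3,5)
        by (auto simp: index_eliminate[OF N] D(4,5) simp del: index_mult_mat(1))
    qed
  qed
qed


section \<open>Invariants of the elimination\<close>

lemma invertible_mat_column_nonzero:
  fixes N :: "'a :: field mat"
  assumes "N \<in> carrier_mat d d" "invertible_mat N" "c < d"
  obtains r where "r < d" "N $$ (r, c) \<noteq> 0"
proof (rule ccontr)
  assume "\<not> thesis"
  with that have *: "\<And>r. r < d \<Longrightarrow> N $$ (r, c) = 0" by blast
  note inv = mat_inv[OF assms(1,2)]
  have "1 = (mat_inv N * N) $$ (c, c)" using inv(3) assms(3) by simp
  also have "\<dots> = 0"
    using inv(1) assms * by (auto simp: scalar_prod_def intro!: sum.neutral)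
  finally show False by simp
qed

lemma cleared_incomplete:
  fixes N :: "'a :: field mat"
  assumes N: "N \<in> carrier_mat d d" "invertible_mat N" and "cleared d N ps" "length ps < d"
  obtains r c where "r < d" "c < d" "(r, c) \<notin> set ps" "N $$ (r, c) \<noteq> 0"
proof -
  have "card (snd ` set ps) < d"
    using card_image_le[of "set ps" snd] card_length[of ps] assms(4) by simp
  then have "\<not> {..<d} \<subseteq> snd ` set ps"
    using card_mono[of "snd ` set ps" "{..<d}"] by auto
  then obtain c where c: "c < d" "c \<notin> snd ` set ps" by auto
  obtain r where "r < d" "N $$ (r, c) \<noteq> 0"
    using invertible_mat_column_nonzero[OF N c(1)] by blast
  then show thesis using c by (intro that[of r c]) force+
qed

text \<open>The order by valuation, then column, then row is antisymmetric, so the definite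
  description in \<open>sa_pivot\<close> is meaningful.\<close>

lemma is_pivot_unique:
  assumes "is_pivot val N ps p" "is_pivot val N ps q"
  shows "p = q"
proof -
  obtain r c r' c' where [simp]: "p = (r, c)" "q = (r', c')" by (cases p; cases q)
  have "val (N $$ (r, c)) < val (N $$ (r', c')) \<or>
      val (N $$ (r, c)) = val (N $$ (r', c')) \<and> (c < c' \<or> c = c' \<and> r \<le> r')"
    "val (N $$ (r', c')) < val (N $$ (r, c)) \<or>
      val (N $$ (r', c')) = val (N $$ (r, c)) \<and> (c' < c \<or> c' = c \<and> r' \<le> r)"
    using assms unfolding is_pivot_def by auto
  then show ?thesis by auto
qed

lemma sa_pivot_eq: "is_pivot val N ps p \<Longrightarrow> sa_pivot val N ps = p"
  unfolding sa_pivot_def using is_pivot_unique by blast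

lemma is_pivot_exists:
  assumes "r < dim_row N" "c < dim_col N" "(r, c) \<notin> set ps"
  obtains p where "is_pivot val N ps p"
proof -
  define S where "S = {(i, j). i < dim_row N \<and> j < dim_col N \<and> (i, j) \<notin> set ps}"
  define m where "m = Min ((\<lambda>p. val (N $$ p)) ` S)"
  have "finite S"
    by (rule finite_subset[of _ "{..<dim_row N} \<times> {..<dim_col N}"]) (auto simp: S_def)
  moreover have "S \<noteq> {}" using assms by (auto simp: S_def)
  ultimately have "m \<in> (\<lambda>p. val (N $$ p)) ` S" and m2: "\<And>p. p \<in> S \<Longrightarrow> m \<le> val (N $$ p)"
    by (auto simp: m_def intro!: Min_in)
  then have m: "\<exists>j i. (i, j) \<in> S \<and> val (N $$ (i, j)) = m" by force
  define c0 where "c0 = (LEAST j. \<exists>i. (i, j) \<in> S \<and> val (N $$ (i, j)) = m)"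
  have c0: "\<exists>i. (i, c0) \<in> S \<and> val (N $$ (i, c0)) = m"
    unfolding c0_def by (rule LeastI_ex) (rule m)
  define r0 where "r0 = (LEAST i. (i, c0) \<in> S \<and> val (N $$ (i, c0)) = m)"
  have r0: "(r0, c0) \<in> S \<and> val (N $$ (r0, c0)) = m"
    unfolding r0_def by (rule LeastI_ex) (rule c0)
  have "val (N $$ (r0, c0)) < val (N $$ (i, j)) \<or>
      val (N $$ (r0, c0)) = val (N $$ (i, j)) \<and> (c0 < j \<or> c0 = j \<and> r0 \<le> i)" if "(i, j) \<in> S" for i j
  proof (cases "val (N $$ (i, j)) = m")
    case True
    then have "c0 \<le> j" unfolding c0_def using that by (intro Least_le) blast
    moreover have "r0 \<le> i" if "c0 = j"
      unfolding r0_def using that True \<open>(i, j) \<in> S\<close> by (intro Least_le) blast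
    ultimately show ?thesis using r0 True by auto
  next
    case False
    with m2[OF that] r0 show ?thesis by auto
  qed
  with r0 have "is_pivot val N ps (r0, c0)"
    by (auto simp: is_pivot_def S_def)
  then show thesis by (rule that)
qed

lemma is_pivot_le:
  assumes "is_pivot val N ps p" "i < dim_row N" "j < dim_col N" "(i, j) \<notin> set ps"
  shows "val (N $$ p) \<le> val (N $$ (i, j))"
  using assms by (cases p) (force simp: is_pivot_def)

section \<open>Partial runs of the algorithm\<close>

definition sa_run ::
  "('a :: field \<Rightarrow> int extended) \<Rightarrow> nat \<Rightarrow> 'a mat \<Rightarrow> 'a mat \<Rightarrow> 'a mat \<times> 'a mat \<times> (nat \<times> nat) list" where
  "sa_run val k M1 M2 = (sa_step val ^^ k) (M1, M2, [])"

lemma sa_run_0 [simp]: "sa_run val 0 M1 M2 = (M1, M2, [])"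
  and sa_run_Suc: "sa_run val (Suc k) M1 M2 = sa_step val (sa_run val k M1 M2)"
  by (simp_all add: sa_run_def)

definition elim_state :: "nat \<Rightarrow> 'a :: field mat \<times> 'a mat \<times> (nat \<times> nat) list \<Rightarrow> bool" where
  "elim_state d = (\<lambda>(B, C, ps). B \<in> carrier_mat d d \<and> invertible_mat B \<and>
     C \<in> carrier_mat d d \<and> invertible_mat C \<and> cleared d (mat_inv B * C) ps)"

lemma elim_stateD:
  assumes "elim_state d (B, C, ps)"
  shows "B \<in> carrier_mat d d" "invertible_mat B" "C \<in> carrier_mat d d" "invertible_mat C"
    "mat_inv B \<in> carrier_mat d d" "mat_inv B * C \<in> carrier_mat d d" "invertible_mat (mat_inv B * C)"
    "cleared d (mat_inv B * C) ps"
  using assms mat_inv[of B d] mat_inv_mat_inv[of B d] mat_inv_mult(2)[of "mat_inv B" d C]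
  by (auto simp: elim_state_def)

lemma elim_state_Nil:
  assumes "B \<in> carrier_mat d d" "invertible_mat B" "C \<in> carrier_mat d d" "invertible_mat C"
  shows "elim_state d (B, C, [])"
  using assms by (simp add: elim_state_def cleared_def)

text \<open>In terms of \<open>N\<close> a step is the two-sided multiplication
  \<open>L * N * R\<close>, because the inverse of \<open>B * mat_inv L\<close> is
  \<open>L * mat_inv B\<close>.\<close>

lemma elim_step_state:
  fixes B C :: "'a :: field mat"
  assumes st: "elim_state d (B, C, ps)"
    and p: "r < d" "c < d" "(r, c) \<notin> set ps" "(mat_inv B * C) $$ (r, c) \<noteq> 0"
  defines "N \<equiv> mat_inv B * C"
  defines "L \<equiv> elim_left N (r, c)"
  defines "R \<equiv> elim_right (L * N) (r, c)"
  shows "elim_step (r, c) (B, C, ps) = (B * mat_inv L, C * R, ps @ [(r, c)])"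
    "mat_inv (B * mat_inv L) * (C * R) = L * N * R"
    "elim_state d (elim_step (r, c) (B, C, ps))"
proof -
  note D = elim_stateD[OF st]
  show step: "elim_step (r, c) (B, C, ps) = (B * mat_inv L, C * R, ps @ [(r, c)])"
    by (simp add: elim_step_def Let_def N_def L_def R_def)
  have N: "N \<in> carrier_mat d d" using D by (simp add: N_def)
  have L: "L \<in> carrier_mat d d" "invertible_mat L"
    using p col_shear_inverse[OF p(1)] N
    by (auto simp: L_def elim_left_eq[OF N] intro: invertible_matI[OF _ _ col_shear_inverse])
  then have LN: "L * N \<in> carrier_mat d d" using N by simp
  have R: "R \<in> carrier_mat d d" "invertible_mat R"
    using p row_shear_inverse[OF p(2)] LN
    by (auto simp: R_def elim_right_eq[OF LN] intro: invertible_matI[OF _ _ row_shear_inverse])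
  note invL = mat_inv[OF L] mat_inv_mat_inv[OF L]
  have "mat_inv (B * mat_inv L) * (C * R) = L * mat_inv B * (C * R)"
    using D L invL by (simp add: mat_inv_mult[of _ d])
  also have "\<dots> = L * (mat_inv B * (C * R))"
    by (rule assoc_mult_mat) (use D L R in auto)
  also have "mat_inv B * (C * R) = N * R"
    unfolding N_def by (rule assoc_mult_mat[symmetric]) (use D L R in auto)
  also have "L * (N * R) = L * N * R"
    by (rule assoc_mult_mat[symmetric]) (use L N R in auto)
  finally show eq: "mat_inv (B * mat_inv L) * (C * R) = L * N * R" .
  have "cleared d (L * N * R) (ps @ [(r, c)])"
    unfolding R_def L_def using N D(8) p by (intro cleared_eliminate) (auto simp: N_def)
  then show "elim_state d (elim_step (r, c) (B, C, ps))"
    unfolding step using D L R invL eq mat_inv_mult(2)[of B d "mat_inv L"] mat_inv_mult(2)[of C d R]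
    by (auto simp: elim_state_def)
qed

lemma mult_mat_diag_assoc:
  assumes "B \<in> carrier_mat d d" "C \<in> carrier_mat d d"
  shows "B * (C * mat_diag d f) = B * C * mat_diag d f"
  by (rule assoc_mult_mat[OF assms mat_diag_dim, symmetric])

text \<open>The left factor is made of ratios within column \<open>c\<close>, where
  \<open>f c\<close> cancels, so the basis does not notice the scaling. The right factor is
  conjugated by the diagonal matrix, which thereby reappears as the last factor.\<close>

lemma elim_step_mult_diag:
  fixes B C :: "'a :: field mat"
  assumes st: "elim_state d (B, C, ps)" and p: "r < d" "c < d"
    and f: "\<And>i. i < d \<Longrightarrow> f i \<noteq> 0"
  shows "elim_step (r, c) (B, C * mat_diag d f, ps) =
    (case elim_step (r, c) (B, C, ps) of (B', C', ps') \<Rightarrow> (B', C' * mat_diag d f, ps'))"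
proof -
  note D = elim_stateD[OF st]
  define N where "N = mat_inv B * C"
  have N: "N \<in> carrier_mat d d" using D by (simp add: N_def)
  have ND: "mat_inv B * (C * mat_diag d f) = N * mat_diag d f"
    unfolding N_def using D by (intro mult_mat_diag_assoc) auto
  have ij: "(N * mat_diag d f) $$ (i, j) = N $$ (i, j) * f j" if "N \<in> carrier_mat d d" "i < d" "j < d" for i j N
    using that by (simp add: mat_diag_mult_right[of _ d])
  have NDc: "N * mat_diag d f \<in> carrier_mat d d" using N by simp
  have L: "elim_left (N * mat_diag d f) (r, c) = elim_left N (r, c)"
    unfolding elim_left_eq[OF N] elim_left_eq[OF NDc] using p f
    by (auto simp: col_shear_def ij[OF N] simp del: index_mult_mat intro!: eq_matI)
  define L where "L = elim_left N (r, c)"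
  have Lc: "L \<in> carrier_mat d d" by (simp add: L_def elim_left_eq[OF N])
  define N' where "N' = L * N"
  have N': "N' \<in> carrier_mat d d" using Lc N by (simp add: N'_def)
  have N'Dc: "N' * mat_diag d f \<in> carrier_mat d d" using N' by simp
  have LND: "L * (N * mat_diag d f) = N' * mat_diag d f"
    unfolding N'_def using Lc N by (intro mult_mat_diag_assoc)
  define R R' where "R = elim_right N' (r, c)" and "R' = elim_right (N' * mat_diag d f) (r, c)"
  have Rc: "R \<in> carrier_mat d d" "R' \<in> carrier_mat d d"
    using N' N'Dc by (auto simp: R_def R'_def elim_right_eq[of _ d])
  have "mat_diag d f * R' = R * mat_diag d f"
    unfolding R_def R'_def elim_right_eq[OF N'] elim_right_eq[OF N'Dc] using p f
    by (subst mat_diag_mult_left[of _ _ d], simp, subst mat_diag_mult_right[of _ d], simp)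
       (auto simp: row_shear_def ij[OF N'] simp del: index_mult_mat intro!: eq_matI)
  then have "C * (mat_diag d f * R') = C * (R * mat_diag d f)" by simp
  also have "\<dots> = C * R * mat_diag d f"
    by (rule mult_mat_diag_assoc[OF D(3) Rc(1)])
  also have "C * (mat_diag d f * R') = C * mat_diag d f * R'"
    by (rule assoc_mult_mat[OF D(3) mat_diag_dim Rc(2), symmetric])
  finally show ?thesis
    by (simp add: elim_step_def Let_def ND L R'_def R_def N'_def L_def LND[unfolded L_def N'_def]
        flip: N_def)
qed

context discrete_valuation
begin

text \<open>The pivot has at most the valuation of some nonzero entry outside \<open>ps\<close>,
  hence a finite one. The diagonal factor covers scaled and unscaled matrices at once, the latter
  with \<open>f = (\<lambda>_. 1)\<close>.\<close>

lemma is_pivot_nonzero: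
  assumes st: "elim_state d (B, C, ps)" and "length ps < d"
    and "is_pivot val (mat_inv B * C * mat_diag d f) ps p" "\<And>i. i < d \<Longrightarrow> f i \<noteq> 0"
  shows "fst p < d" "snd p < d" "p \<notin> set ps" "(mat_inv B * C) $$ p \<noteq> 0"
proof -
  let ?N = "mat_inv B * C"
  note D = elim_stateD[OF st]
  obtain r c where p: "p = (r, c)" by force
  show less: "fst p < d" "snd p < d" "p \<notin> set ps"
    using assms(3) D by (auto simp: is_pivot_def p mat_diag_mult_right[of _ d])
  obtain i j where ij: "i < d" "j < d" "(i, j) \<notin> set ps" "?N $$ (i, j) \<noteq> 0"
    using cleared_incomplete[OF D(6,7,8) assms(2)] .
  have "val ((?N * mat_diag d f) $$ p) \<le> val ((?N * mat_diag d f) $$ (i, j))"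
    using D ij by (intro is_pivot_le[OF assms(3)]) (auto simp: mat_diag_mult_right[of _ d])
  moreover have "(?N * mat_diag d f) $$ (i, j) \<noteq> 0"
    using D(6) ij assms(4) by (simp add: mat_diag_mult_right[of _ d] del: index_mult_mat)
  ultimately have "(?N * mat_diag d f) $$ p \<noteq> 0"
    by (metis Pinf_le val_eq_Pinf_iff)
  then show "?N $$ p \<noteq> 0"
    using D(6) less by (auto simp: p mat_diag_mult_right[of _ d] simp del: index_mult_mat)
qed

lemma sa_pivot_is_pivot:
  assumes st: "elim_state d (B, C, ps)" and "length ps < d"
  shows "is_pivot val (mat_inv B * C * mat_diag d f) ps
    (sa_pivot val (mat_inv B * C * mat_diag d f) ps)"
proof -
  note D = elim_stateD[OF st]
  obtain r c where "r < d" "c < d" "(r, c) \<notin> set ps"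
    using cleared_incomplete[OF D(6,7,8) assms(2)] by blast
  then obtain p where "is_pivot val (mat_inv B * C * mat_diag d f) ps p"
    using D is_pivot_exists[of r "mat_inv B * C * mat_diag d f" c ps val]
    by (auto simp: mat_diag_mult_right[of _ d])
  then show ?thesis using sa_pivot_eq by metis
qed

text \<open>Minimality of the pivot makes all multipliers integral, so both elimination matrices are
  invertible over \<open>\<O>\<close> and neither lattice changes.\<close>

lemma sa_run_state:
  assumes M: "M1 \<in> carrier_mat d d" "invertible_mat M1" "M2 \<in> carrier_mat d d" "invertible_mat M2"
    and "k \<le> d" "sa_run val k M1 M2 = (B, C, ps)"
  shows "elim_state d (B, C, ps) \<and> length ps = k \<and>
    mat_lattice val B = mat_lattice val M1 \<and> mat_lattice val C = mat_lattice val M2"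
  using assms(5,6)
proof (induction k arbitrary: B C ps)
  case 0
  then show ?case using M by (simp add: elim_state_Nil)
next
  case (Suc k)
  obtain B0 C0 ps0 where run: "sa_run val k M1 M2 = (B0, C0, ps0)" by (metis prod_cases3)
  with Suc have st: "elim_state d (B0, C0, ps0)" and len: "length ps0 = k"
    and lat: "mat_lattice val B0 = mat_lattice val M1" "mat_lattice val C0 = mat_lattice val M2"
    by auto
  note D = elim_stateD[OF st]
  define N where "N = mat_inv B0 * C0"
  have N: "N \<in> carrier_mat d d" using D by (simp add: N_def)
  have N1: "mat_inv B0 * C0 * mat_diag d (\<lambda>_. 1) = N"
    unfolding mat_diag_one N_def[symmetric] by (rule right_mult_one_mat[OF N])
  obtain r c where p: "sa_pivot val N ps0 = (r, c)" by force
  have piv: "is_pivot val N ps0 (r, c)"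
    using sa_pivot_is_pivot[OF st, of "\<lambda>_. 1"] Suc.prems len p by (simp only: N1)
  have nz: "r < d" "c < d" "(r, c) \<notin> set ps0" "N $$ (r, c) \<noteq> 0"
    using is_pivot_nonzero[OF st, of "\<lambda>_. 1" "(r, c)"] Suc.prems len piv
    unfolding N1 by (auto simp flip: N_def)
  define L where "L = elim_left N (r, c)"
  define R where "R = elim_right (L * N) (r, c)"
  note step = elim_step_state[OF st nz[unfolded N_def]]
  have eq: "(B, C, ps) = (B0 * mat_inv L, C0 * R, ps0 @ [(r, c)])"
    using Suc.prems run p step(1) by (simp add: sa_run_Suc sa_step_eq N_def L_def R_def)
  have Lc: "L = col_shear d r (\<lambda>i. - (N $$ (i, c) / N $$ (r, c)))"
    using N by (simp add: L_def elim_left_eq)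
  have invL: "mat_inv L = col_shear d r (\<lambda>i. N $$ (i, c) / N $$ (r, c))"
    using col_shear_inverse[OF nz(1), of "\<lambda>i. - (N $$ (i, c) / N $$ (r, c))"]
    unfolding Lc by (intro mat_inv_unique) auto
  have LN: "L * N \<in> carrier_mat d d"
    unfolding Lc by (rule mult_carrier_mat[OF shear_carrier(1) N])
  have LNr: "(L * N) $$ (r, j) = N $$ (r, j)" if "j < d" for j
    unfolding Lc using that nz N by (subst index_col_shear_mult) auto
  have Rc: "R = row_shear d c (\<lambda>j. - (N $$ (r, j) / N $$ (r, c)))"
    unfolding R_def elim_right_eq[OF LN] row_shear_def using nz(2)
    by (auto simp: LNr simp del: index_mult_mat intro!: eq_matI)
  \<comment> \<open>Column \<open>c\<close> holds no earlier pivot, so minimality of the new one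
    extends over the whole column; the same holds for row \<open>r\<close> below.\<close>
  have col: "N $$ (i, c) / N $$ (r, c) \<in> \<O>" if "i < d" for i
  proof -
    have "(i, c) \<notin> set ps0"
      using cleared_fresh[of d N ps0 r c] D(8) nz by (force simp: N_def)
    then show ?thesis
      using is_pivot_le[OF piv, of i c] nz that N by (simp flip: val_le_iff_divide)
  qed
  have row: "N $$ (r, j) / N $$ (r, c) \<in> \<O>" if "j < d" for j
  proof -
    have "(r, j) \<notin> set ps0"
      using cleared_fresh[of d N ps0 r c] D(8) nz by (force simp: N_def)
    then show ?thesis
      using is_pivot_le[OF piv, of r j] nz that N by (simp flip: val_le_iff_divide)
  qed
  have int: "L \<in> integral_mats d" "mat_inv L \<in> integral_mats d" "R \<in> integral_mats d"
    "row_shear d c (\<lambda>j. N $$ (r, j) / N $$ (r, c)) \<in> integral_mats d"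
    using row col unfolding invL unfolding Lc Rc
    by (auto simp: integral_mats_def col_shear_def row_shear_def simp flip: minus_divide_left)
  have "mat_inv L * L = 1\<^sub>m d"
    using col_shear_inverse[OF nz(1), of "\<lambda>i. N $$ (i, c) / N $$ (r, c)"] unfolding invL by (simp add: Lc)
  then have "mat_lattice val (B0 * mat_inv L) = mat_lattice val B0"
    by (rule mat_lattice_mult_unimodular[OF D(1) int(2,1)])
  moreover have "R * row_shear d c (\<lambda>j. N $$ (r, j) / N $$ (r, c)) = 1\<^sub>m d"
    using row_shear_inverse[OF nz(2), of "\<lambda>j. - (N $$ (r, j) / N $$ (r, c))"] by (simp add: Rc)
  then have "mat_lattice val (C0 * R) = mat_lattice val C0"
    by (rule mat_lattice_mult_unimodular[OF D(3) int(3,4)])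
  ultimately show ?case
    using step(1,3) lat len eq by (simp add: N_def L_def R_def)
qed

end


section \<open>SA-bases\<close>

text \<open>With \<open>d - 1\<close> pivots exactly one row and one column are free, and the
  remaining nonzero entry sits where they cross. It is the pivot that the main loop leaves
  undetermined.\<close>

lemma cleared_complete:
  fixes N :: "'a :: field mat"
  assumes N: "N \<in> carrier_mat d d" "invertible_mat N" and ps: "cleared d N ps" "Suc (length ps) = d"
  obtains r c where "cleared d N (ps @ [(r, c)])"
    "(THE p. fst p < dim_row N \<and> snd p < dim_col N \<and> p \<notin> set ps \<and> N $$ p \<noteq> 0) = (r, c)"
proof -
  obtain r c where rc: "r < d" "c < d" "(r, c) \<notin> set ps" "N $$ (r, c) \<noteq> 0"
    using cleared_incomplete[OF N ps(1)] ps(2) by auto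
  have card1: "is_singleton ({..<d} - h ` set ps)"
    if "distinct (map h ps)" "h ` set ps \<subseteq> {..<d}" for h :: "nat \<times> nat \<Rightarrow> nat"
  proof -
    have "card (h ` set ps) = length ps"
      using distinct_card[OF that(1)] by simp
    then have "card ({..<d} - h ` set ps) = 1"
      using that(2) ps(2) by (subst card_Diff_subset) auto
    then show ?thesis by (simp add: is_singleton_altdef)
  qed
  have "is_singleton ({..<d} - fst ` set ps)" "is_singleton ({..<d} - snd ` set ps)"
    using ps(1) by (auto simp: cleared_def intro!: card1)
  then obtain r0 c0 where "{..<d} - fst ` set ps = {r0}" "{..<d} - snd ` set ps = {c0}"
    by (auto simp: is_singleton_def)
  then have only: "i = r0" "j = c0"
    if "i < d" "j < d" "(i, j) \<notin> set ps" "N $$ (i, j) \<noteq> 0" for i j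
    using cleared_fresh[OF ps(1) that] that by blast+
  have unique: "(i, j) = (r, c)"
    if "i < d" "j < d" "(i, j) \<notin> set ps" "N $$ (i, j) \<noteq> 0" for i j
    using only[OF that] only[OF rc] by simp
  have "cleared d N (ps @ [(r, c)])"
    unfolding cleared_def
  proof (intro conjI ballI)
    show "distinct (map fst (ps @ [(r, c)]))" "distinct (map snd (ps @ [(r, c)]))"
      using ps(1) cleared_fresh[OF ps(1) rc] by (auto simp: cleared_def)
  next
    fix q assume q: "q \<in> set (ps @ [(r, c)])"
    have "N $$ (i, c) = 0" if "i < d" "i \<noteq> r" for i
    proof -
      have "(i, c) \<notin> set ps" using cleared_fresh(2)[OF ps(1) rc] by force
      then show ?thesis using unique[of i c] that rc by auto
    qed
    moreover have "N $$ (r, j) = 0" if "j < d" "j \<noteq> c" for j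
    proof -
      have "(r, j) \<notin> set ps" using cleared_fresh(1)[OF ps(1) rc] by force
      then show ?thesis using unique[of r j] that rc by auto
    qed
    ultimately have new: "r < d \<and> c < d \<and> N $$ (r, c) \<noteq> 0 \<and>
        (\<forall>i < d. i \<noteq> r \<longrightarrow> N $$ (i, c) = 0) \<and> (\<forall>j < d. j \<noteq> c \<longrightarrow> N $$ (r, j) = 0)"
      using rc by blast
    show "case q of (r, c) \<Rightarrow> r < d \<and> c < d \<and> N $$ (r, c) \<noteq> 0 \<and>
        (\<forall>i < d. i \<noteq> r \<longrightarrow> N $$ (i, c) = 0) \<and> (\<forall>j < d. j \<noteq> c \<longrightarrow> N $$ (r, j) = 0)"
    proof (cases "q = (r, c)")
      case True
      show ?thesis unfolding True prod.case by (rule new)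
    next
      case False
      then have "q \<in> set ps" using q by simp
      then show ?thesis using ps(1) unfolding cleared_def by blast
    qed
  qed
  moreover have "(THE p. fst p < dim_row N \<and> snd p < dim_col N \<and> p \<notin> set ps \<and> N $$ p \<noteq> 0) = (r, c)"
  proof (rule the_equality)
    show "p = (r, c)"
      if "fst p < dim_row N \<and> snd p < dim_col N \<and> p \<notin> set ps \<and> N $$ p \<noteq> 0" for p
      using that unique[of "fst p" "snd p"] N by simp
  qed (use N rc in simp)
  ultimately show thesis by (rule that)
qed

context discrete_valuation
begin

text \<open>A monomial matrix is a diagonal matrix times a permutation matrix, and the latter is
  invertible over \<open>\<O>\<close>.\<close>

lemma mat_lattice_mult_monomial:
  assumes B: "B \<in> carrier_mat d d" and N: "N \<in> carrier_mat d d"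
    and qs: "cleared d N qs" "length qs = d"
  shows "adapted d B (mat_lattice val (B * N))"
proof -
  have "fst ` set qs = {..<d}"
  proof (rule card_subset_eq)
    show "card (fst ` set qs) = card {..<d}"
      using qs distinct_card[of "map fst qs"] by (auto simp: cleared_def)
  qed (use qs in \<open>auto simp: cleared_def\<close>)
  then have "i \<in> fst ` set qs" if "i < d" for i using that by simp
  then have "\<forall>i<d. \<exists>c. (i, c) \<in> set qs" by force
  then obtain \<sigma> where \<sigma>: "\<And>i. i < d \<Longrightarrow> (i, \<sigma> i) \<in> set qs" by metis
  have nz: "\<sigma> i < d" "N $$ (i, \<sigma> i) \<noteq> 0" if "i < d" for i
    using clearedD(2,3)[OF qs(1) \<sigma>[OF that]] .
  have col: "N $$ (k, \<sigma> i) = 0" if "i < d" "k < d" "k \<noteq> i" for i k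
    using clearedD(4)[OF qs(1) \<sigma>[OF that(1)] that(2,3)] .
  have row: "N $$ (i, k) = 0" if "i < d" "k < d" "k \<noteq> \<sigma> i" for i k
    using clearedD(5)[OF qs(1) \<sigma>[OF that(1)] that(2,3)] .
  define f where "f i = N $$ (i, \<sigma> i)" for i
  have f: "f i \<noteq> 0" if "i < d" for i using nz that by (simp add: f_def)
  have inj: "i = j" if "\<sigma> i = \<sigma> j" "i < d" "j < d" for i j
    using nz(2)[of j] col[of i j] that by metis
  \<comment> \<open>The permutation matrix of \<open>\<sigma>\<close> and its transpose, which is
    its inverse.\<close>
  define U :: "'a mat" where "U = mat d d (\<lambda>(i, j). if j = \<sigma> i then 1 else 0)"
  define V :: "'a mat" where "V = mat d d (\<lambda>(i, j). if i = \<sigma> j then 1 else 0)"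
  have UV: "U \<in> integral_mats d" "V \<in> integral_mats d"
    by (auto simp: U_def V_def integral_mats_def)
  have Uc: "U \<in> carrier_mat d d" by (simp add: U_def)
  have "(U * V) $$ (i, j) = (if i = j then 1 else 0)" if "i < d" "j < d" for i j
  proof -
    have "(U * V) $$ (i, j) = (\<Sum>k<d. U $$ (i, k) * V $$ (k, j))"
      using that by (simp add: U_def V_def scalar_prod_def atLeast0LessThan)
    also have "\<dots> = (\<Sum>k<d. if \<sigma> i = k then (if k = \<sigma> j then 1 else 0) else 0)"
      using that by (intro sum.cong) (auto simp: U_def V_def)
    also have "\<dots> = (if \<sigma> i = \<sigma> j then 1 else 0)"
      using nz(1)[OF that(1)] by simp
    also have "\<dots> = (if i = j then 1 else 0)" using inj that by auto
    finally show ?thesis .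
  qed
  then have "U * V = 1\<^sub>m d"
    by (intro eq_matI) (auto simp: U_def V_def simp del: index_mult_mat(1))
  moreover have "N = mat_diag d f * U"
    using N row by (subst mat_diag_mult_left[OF Uc]) (auto simp: U_def f_def intro!: eq_matI)
  then have "B * N = B * mat_diag d f * U"
    using assoc_mult_mat[OF B mat_diag_dim Uc] by simp
  ultimately have "mat_lattice val (B * N) = mat_lattice val (B * mat_diag d f)"
    using mat_lattice_mult_unimodular[OF mult_carrier_mat[OF B mat_diag_dim] UV] by simp
  with f show ?thesis by (auto simp: adapted_def)
qed

text \<open>The run preserves both lattices. The columns of \<open>B\<close> span the first one, and
  \<open>C = B * N\<close> spans the second, where \<open>N\<close> is monomial after
  \<open>d - 1\<close> steps.\<close>

lemma sa_basis_adapted: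
  assumes M: "M1 \<in> carrier_mat d d" "invertible_mat M1" "M2 \<in> carrier_mat d d" "invertible_mat M2"
    and d: "1 \<le> d"
  shows "sa_basis val M1 M2 \<in> carrier_mat d d" "invertible_mat (sa_basis val M1 M2)"
    "adapted d (sa_basis val M1 M2) (mat_lattice val M1)"
    "adapted d (sa_basis val M1 M2) (mat_lattice val M2)"
proof -
  obtain B C ps where run: "sa_run val (d - 1) M1 M2 = (B, C, ps)" by (metis prod_cases3)
  have B: "sa_basis val M1 M2 = B"
    using run M by (simp add: sa_basis_def sa_final_def sa_run_def)
  have st: "elim_state d (B, C, ps)" and len: "length ps = d - 1"
    and lat: "mat_lattice val B = mat_lattice val M1" "mat_lattice val C = mat_lattice val M2"
    using sa_run_state[OF M _ run] by auto
  note D = elim_stateD[OF st]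
  have "Suc (length ps) = d" using len d by simp
  from cleared_complete[OF D(6,7,8) this]
  obtain r c where "cleared d (mat_inv B * C) (ps @ [(r, c)])" .
  moreover have "B * (mat_inv B * C) = B * mat_inv B * C"
    by (rule assoc_mult_mat[OF D(1,5,3), symmetric])
  then have "B * (mat_inv B * C) = C"
    using mat_inv(2)[OF D(1,2)] D(3) by simp
  ultimately have "adapted d B (mat_lattice val C)"
    using mat_lattice_mult_monomial[OF D(1,6), of "ps @ [(r, c)]"] len d by simp
  then show "sa_basis val M1 M2 \<in> carrier_mat d d" "invertible_mat (sa_basis val M1 M2)"
    "adapted d (sa_basis val M1 M2) (mat_lattice val M1)"
    "adapted d (sa_basis val M1 M2) (mat_lattice val M2)"
    using D adapted_self[OF D(1)] by (simp_all add: B lat)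
qed

section \<open>Effect of column scaling on the run\<close>

lemma val_mult_less_iff: "z \<noteq> 0 \<Longrightarrow> val (x * z) < val (y * z) \<longleftrightarrow> val x < val y"
  and val_mult_eq_iff: "z \<noteq> 0 \<Longrightarrow> val (x * z) = val (y * z) \<longleftrightarrow> val x = val y"
  by (rule val_FinE[of z], assumption, cases "val x"; cases "val y"; simp add: val_mult)+

text \<open>A uniform shift of the values in column \<open>c\<close> keeps the set of minima there,
  and both pivots are its topmost element.\<close>

lemma is_pivot_row_mult_diag:
  assumes N: "N \<in> carrier_mat d d"
    and "is_pivot val N ps (r, c)" "is_pivot val (N * mat_diag d f) ps (r', c)" "f c \<noteq> 0"
  shows "r = r'"
proof -
  have *: "r < d" "c < d" "r' < d" "(r, c) \<notin> set ps" "(r', c) \<notin> set ps"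
    using assms by (auto simp: is_pivot_def mat_diag_mult_right[of _ d])
  then have "val (N $$ (r, c)) < val (N $$ (r', c)) \<or> val (N $$ (r, c)) = val (N $$ (r', c)) \<and> r \<le> r'"
    using assms(1,2) by (fastforce simp: is_pivot_def)
  moreover have "val (N $$ (r', c) * f c) < val (N $$ (r, c) * f c) \<or>
      val (N $$ (r', c) * f c) = val (N $$ (r, c) * f c) \<and> r' \<le> r"
    using assms(1,3) * unfolding mat_diag_mult_right[OF N] by (fastforce simp: is_pivot_def)
  ultimately show ?thesis using assms(4) by (auto simp: val_mult_less_iff val_mult_eq_iff)
qed

text \<open>As long as the two runs agree up to the right factor \<open>mat_diag d f\<close>, the
  next step sees matrices that differ by the same factor. Equal columns then force equal rows, and
  the factor is carried along to the end.\<close>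

lemma sa_run_mult_diag:
  assumes M: "M \<in> carrier_mat d d" "invertible_mat M" "A \<in> carrier_mat d d" "invertible_mat A"
    and f: "\<And>i. i < d \<Longrightarrow> f i \<noteq> 0"
    and "k \<le> d" "sa_run val k M A = (B, C, ps)" "sa_run val k M (A * mat_diag d f) = (B', C', ps')"
    and "map snd ps = map snd ps'"
  shows "B' = B \<and> C' = C * mat_diag d f \<and> ps' = ps"
  using assms(6-)
proof (induction k arbitrary: B C ps B' C' ps')
  case 0
  then show ?case by auto
next
  case (Suc k)
  obtain B0 C0 ps0 where run: "sa_run val k M A = (B0, C0, ps0)" by (metis prod_cases3)
  obtain B0' C0' ps0' where run': "sa_run val k M (A * mat_diag d f) = (B0', C0', ps0')"
    by (metis prod_cases3)
  have st: "elim_state d (B0, C0, ps0)" and len: "length ps0 = k"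
    using sa_run_state[OF M _ run] Suc.prems by auto
  note D = elim_stateD[OF st]
  define p where "p = sa_pivot val (mat_inv B0 * C0) ps0"
  define p' where "p' = sa_pivot val (mat_inv B0' * C0') ps0'"
  have step: "elim_step p (B0, C0, ps0) = (B, C, ps)" "elim_step p' (B0', C0', ps0') = (B', C', ps')"
    using Suc.prems(2,3) run run' by (simp_all add: sa_run_Suc sa_step_eq p_def p'_def)
  then have ps: "ps = ps0 @ [p]" "ps' = ps0' @ [p']"
    by (simp_all add: elim_step_def Let_def)
  with Suc.prems(4) have snd: "map snd ps0 = map snd ps0'" "snd p = snd p'" by simp_all
  with Suc.IH[OF _ run run'] Suc.prems(1)
  have eq: "B0' = B0" "C0' = C0 * mat_diag d f" "ps0' = ps0" by auto
  have N1: "mat_inv B0 * C0 * mat_diag d (\<lambda>_. 1) = mat_inv B0 * C0"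
    unfolding mat_diag_one by (rule right_mult_one_mat[OF D(6)])
  have ND: "mat_inv B0 * (C0 * mat_diag d f) = mat_inv B0 * C0 * mat_diag d f"
    using D by (intro mult_mat_diag_assoc) auto
  have piv: "is_pivot val (mat_inv B0 * C0) ps0 p"
    using sa_pivot_is_pivot[OF st, of "\<lambda>_. 1"] Suc.prems(1) len unfolding N1 p_def by simp
  have piv': "is_pivot val (mat_inv B0 * C0 * mat_diag d f) ps0 p'"
    using sa_pivot_is_pivot[OF st, of f] Suc.prems(1) len unfolding p'_def eq ND by simp
  have less: "fst p < d" "snd p < d"
    using piv D by (auto simp: is_pivot_def)
  obtain r c where p: "p = (r, c)" by force
  with snd obtain r' where p': "p' = (r', c)" by (cases p') auto
  have "r = r'"
    using is_pivot_row_mult_diag[OF D(6)] piv piv' f less unfolding p p' by simp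
  then have "p' = p" by (simp add: p p')
  moreover have "elim_step p (B0, C0 * mat_diag d f, ps0) =
      (case elim_step p (B0, C0, ps0) of (B', C', ps') \<Rightarrow> (B', C' * mat_diag d f, ps'))"
    using elim_step_mult_diag[OF st] less f by (simp add: p)
  ultimately show ?case using step by (simp add: eq)
qed

lemma pivot_columns_permutes:
  assumes "cleared d N qs" "length qs = d"
  obtains \<tau> where "\<tau> permutes {..<d}" "map snd qs = map \<tau> [0..<d]"
proof -
  \<comment> \<open>Arguments outside the range are fixed, as \<open>permutes\<close>
    demands.\<close>
  define \<tau> where "\<tau> i = (if i < d then map snd qs ! i else i)" for i
  have "map snd qs = map \<tau> [0..<d]"
    using assms(2) by (intro nth_equalityI) (auto simp: \<tau>_def)
  moreover have "bij_betw ((!) (map snd qs)) {..<d} {..<d}"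
  proof -
    have "snd ` set qs = {..<d}"
    proof (rule card_subset_eq)
      show "card (snd ` set qs) = card {..<d}"
        using assms distinct_card[of "map snd qs"] by (auto simp: cleared_def)
    qed (use assms in \<open>auto simp: cleared_def\<close>)
    moreover have "distinct (map snd qs)" using assms(1) by (simp add: cleared_def)
    ultimately show ?thesis using assms(2) by (intro bij_betw_nth) auto
  qed
  then have "bij_betw \<tau> {..<d} {..<d}"
    by (subst bij_betw_cong[of _ _ "(!) (map snd qs)"]) (auto simp: \<tau>_def)
  then have "\<tau> permutes {..<d}"
    by (rule bij_imp_permutes) (auto simp: \<tau>_def)
  ultimately show thesis by (intro that)
qed

lemma sa_pivots_snd:
  assumes M: "M \<in> carrier_mat d d" "invertible_mat M" "A \<in> carrier_mat d d" "invertible_mat A"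
    and "1 \<le> d" "sa_run val (d - 1) M A = (B, C, ps)"
  obtains r c where "sa_pivots val M A = ps @ [(r, c)]" "cleared d (mat_inv B * C) (ps @ [(r, c)])"
proof -
  have st: "elim_state d (B, C, ps)" and len: "length ps = d - 1"
    using sa_run_state[OF M _ assms(6)] by auto
  note D = elim_stateD[OF st]
  have "Suc (length ps) = d" using len assms(5) by simp
  from cleared_complete[OF D(6,7,8) this]
  obtain r c where "cleared d (mat_inv B * C) (ps @ [(r, c)])"
    "(THE p. fst p < dim_row (mat_inv B * C) \<and> snd p < dim_col (mat_inv B * C) \<and> p \<notin> set ps \<and>
      (mat_inv B * C) $$ p \<noteq> 0) = (r, c)" .
  moreover have "sa_final val M A = (B, C, ps)"
    using M assms(6) by (simp add: sa_final_def sa_run_def)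
  ultimately show thesis
    by (intro that[of r c]) (simp_all add: sa_pivots_def sa_Delta_def)
qed

lemma mult_mat_diag_invertible:
  fixes A :: "'a mat"
  assumes "A \<in> carrier_mat d d" "invertible_mat A" "\<And>i. i < d \<Longrightarrow> f i \<noteq> 0"
  shows "A * mat_diag d f \<in> carrier_mat d d" "invertible_mat (A * mat_diag d f)"
  using assms mat_inv_mult(2)[OF assms(1,2), of "mat_diag d f"] mat_diag_inverse(2)[of d f] by auto

text \<open>In a fixed column, scaling does not change which entry has minimal valuation. So the order of
  the pivot columns already determines the pivots, hence the elimination matrices acting on the
  left, hence the basis.\<close>

lemma sa_basis_pivot_columns:
  assumes M: "M \<in> carrier_mat d d" "invertible_mat M" "A \<in> carrier_mat d d" "invertible_mat A"
    and "1 \<le> d" and f: "\<And>i. i < d \<Longrightarrow> f i \<noteq> 0" and g: "\<And>i. i < d \<Longrightarrow> g i \<noteq> 0"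
    and "map snd (sa_pivots val M (A * mat_diag d f)) = map snd (sa_pivots val M (A * mat_diag d g))"
  shows "sa_basis val M (A * mat_diag d f) = sa_basis val M (A * mat_diag d g)"
proof -
  have Af: "A * mat_diag d f \<in> carrier_mat d d" "invertible_mat (A * mat_diag d f)"
    and Ag: "A * mat_diag d g \<in> carrier_mat d d" "invertible_mat (A * mat_diag d g)"
    using mult_mat_diag_invertible[OF M(3,4), of f] mult_mat_diag_invertible[OF M(3,4), of g] f g
    by blast+
  obtain B C ps where run: "sa_run val (d - 1) M (A * mat_diag d f) = (B, C, ps)"
    by (metis prod_cases3)
  obtain B' C' ps' where run': "sa_run val (d - 1) M (A * mat_diag d g) = (B', C', ps')"
    by (metis prod_cases3)
  \<comment> \<open>The runs record \<open>d - 1\<close> pivots, so the last entry of both column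
    lists is cut off.\<close>
  have "map snd ps = map snd ps'"
    using assms(8) sa_pivots_snd[OF M(1,2) Af assms(5) run] sa_pivots_snd[OF M(1,2) Ag assms(5) run']
    by (metis butlast_snoc map_butlast)
  \<comment> \<open>Dividing the scalings makes the second input a scaling of the first.\<close>
  moreover have "A * mat_diag d g = A * mat_diag d f * mat_diag d (\<lambda>i. g i / f i)"
    using M(3) f by (simp add: mat_diag_mult_right[of _ d]) (auto intro!: eq_matI)
  ultimately have "B' = B"
    using sa_run_mult_diag[OF M(1,2) Af _ _ run, of "\<lambda>i. g i / f i" B' C' ps'] f g run'
    by simp
  then show ?thesis
    using run run' M(1) by (simp add: sa_basis_def sa_final_def sa_run_def)
qed

end


section \<open>Prescribing the pivot columns\<close>

context discrete_valuation
begin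

text \<open>The tie-breaking is that of the algorithm within one column. Earlier pivots are not
  excluded because this is applied to columns without any.\<close>

definition col_pivot :: "'a mat \<Rightarrow> nat \<Rightarrow> nat \<Rightarrow> bool" where
  "col_pivot N c r \<longleftrightarrow> r < dim_row N \<and> N $$ (r, c) \<noteq> 0 \<and>
     (\<forall>i < dim_row N. val (N $$ (r, c)) < val (N $$ (i, c)) \<or>
        val (N $$ (r, c)) = val (N $$ (i, c)) \<and> r \<le> i)"

lemma col_pivot_exists:
  assumes "i < dim_row N" "N $$ (i, c) \<noteq> 0"
  obtains r where "col_pivot N c r"
proof -
  \<comment> \<open>A matrix consisting of column \<open>c\<close> alone reduces the claim to the
    existence of a pivot with nothing excluded.\<close>
  define N' where "N' = mat (dim_row N) 1 (\<lambda>(i, j). N $$ (i, c))"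
  obtain p where "is_pivot val N' [] p"
    using is_pivot_exists[of i N' 0 "[]"] assms by (auto simp: N'_def)
  then obtain r where r: "r < dim_row N"
    "\<And>i. i < dim_row N \<Longrightarrow> val (N $$ (r, c)) < val (N $$ (i, c)) \<or>
      val (N $$ (r, c)) = val (N $$ (i, c)) \<and> r \<le> i"
    by (cases p) (auto simp: is_pivot_def N'_def)
  then have "val (N $$ (r, c)) \<noteq> Pinf"
    using r(2)[OF assms(1)] assms(2) val_eq_Pinf_iff by (metis less_extended_simps(4))
  then have "N $$ (r, c) \<noteq> 0" by auto
  with r have "col_pivot N c r" by (simp add: col_pivot_def)
  then show thesis by (rule that)
qed

text \<open>Within a column the choice of the pivot does not depend on the scaling, so all pivots can be
  fixed before the exponents that put them in the order \<open>\<tau>\<close> are chosen.\<close>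

primrec forced_run :: "(nat \<Rightarrow> nat) \<Rightarrow> 'a mat \<Rightarrow> 'a mat \<Rightarrow> nat \<Rightarrow> 'a mat \<times> 'a mat \<times> (nat \<times> nat) list" where
  "forced_run \<tau> M A 0 = (M, A, [])"
| "forced_run \<tau> M A (Suc k) = (case forced_run \<tau> M A k of (B, C, ps) \<Rightarrow>
     elim_step (SOME r. col_pivot (mat_inv B * C) (\<tau> k) r, \<tau> k) (B, C, ps))"

lemma forced_col_pivot:
  assumes "elim_state d (B, C, ps)" "c < d"
  shows "col_pivot (mat_inv B * C) c (SOME r. col_pivot (mat_inv B * C) c r)"
proof -
  note D = elim_stateD[OF assms(1)]
  obtain i where i: "i < d" "(mat_inv B * C) $$ (i, c) \<noteq> 0"
    using invertible_mat_column_nonzero[OF D(6,7) assms(2)] .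
  have "i < dim_row (mat_inv B * C)" using i(1) D(6) by (metis carrier_matD(1))
  from col_pivot_exists[of i, OF this i(2)] show ?thesis by (metis someI)
qed

text \<open>Injectivity of \<open>\<tau>\<close> keeps each new column free of earlier pivots, so
  every step is a legitimate elimination.\<close>

lemma forced_run_state:
  assumes M: "M \<in> carrier_mat d d" "invertible_mat M" "A \<in> carrier_mat d d" "invertible_mat A"
    and \<tau>: "\<tau> permutes {..<d}"
    and "k \<le> d" "forced_run \<tau> M A k = (B, C, ps)"
  shows "elim_state d (B, C, ps) \<and> map snd ps = map \<tau> [0..<k]"
  using assms(6,7)
proof (induction k arbitrary: B C ps)
  case 0
  then show ?case using M by (simp add: elim_state_Nil)
next
  case (Suc k)
  obtain B0 C0 ps0 where run: "forced_run \<tau> M A k = (B0, C0, ps0)" by (metis prod_cases3)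
  with Suc have st: "elim_state d (B0, C0, ps0)" and ps0: "map snd ps0 = map \<tau> [0..<k]" by auto
  note D = elim_stateD[OF st]
  have c: "\<tau> k < d" using permutes_in_image[OF \<tau>, of k] Suc.prems(1) by simp
  define r where "r = (SOME r. col_pivot (mat_inv B0 * C0) (\<tau> k) r)"
  have piv: "col_pivot (mat_inv B0 * C0) (\<tau> k) r"
    unfolding r_def using forced_col_pivot[OF st c] .
  have "\<tau> k \<notin> snd ` set ps0"
  proof
    assume "\<tau> k \<in> snd ` set ps0"
    then have "\<tau> k \<in> set (map \<tau> [0..<k])" using ps0 by (metis set_map)
    then obtain m where "m < k" "\<tau> m = \<tau> k" by auto
    then show False using injD[OF permutes_inj[OF \<tau>], of m k] by simp
  qed
  then have "(r, \<tau> k) \<notin> set ps0" by force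
  moreover have "r < d" "(mat_inv B0 * C0) $$ (r, \<tau> k) \<noteq> 0"
    using piv D(5) by (auto simp: col_pivot_def)
  ultimately have "elim_state d (elim_step (r, \<tau> k) (B0, C0, ps0))"
    using c by (intro elim_step_state[OF st])
  moreover have step: "elim_step (r, \<tau> k) (B0, C0, ps0) = (B, C, ps)"
    using Suc.prems(2) run by (simp add: r_def)
  moreover have "ps = ps0 @ [(r, \<tau> k)]"
    using step by (simp add: elim_step_def Let_def)
  ultimately show ?case using ps0 by simp
qed

lemma finite_val_bound:
  assumes "finite X"
  obtains W where "\<And>x. x \<in> X \<Longrightarrow> x \<noteq> 0 \<Longrightarrow> \<exists>n. val x = Fin n \<and> \<bar>n\<bar> \<le> W"
proof -
  \<comment> \<open>The default 0 for infinite values is arbitrary: the bound is claimed for nonzero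
    elements.\<close>
  define g where "g x = (case val x of Fin n \<Rightarrow> \<bar>n\<bar> | _ \<Rightarrow> 0)" for x
  show thesis
  proof (rule that)
    fix x assume "x \<in> X" "x \<noteq> 0"
    obtain n where n: "val x = Fin n" using \<open>x \<noteq> 0\<close> by (rule val_FinE)
    have "g x \<le> Max (g ` X)" using \<open>x \<in> X\<close> assms by (intro Max_ge) auto
    then show "\<exists>n. val x = Fin n \<and> \<bar>n\<bar> \<le> Max (g ` X)" using n by (simp add: g_def)
  qed
qed

text \<open>If all valuations lie in \<open>[- W, W]\<close>, then scaling consecutive pivot columns by exponents
  that differ by \<open>2 * W + 1\<close> gives every nonzero entry of an earlier column smaller valuation than
  every entry of a later one.\<close>

lemma forced_is_pivot:
  assumes st: "elim_state d (B, C, ps)" and snd: "map snd ps = map \<tau> [0..<k]"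
    and \<tau>: "\<tau> permutes {..<d}" and k: "k < d"
    and r: "col_pivot (mat_inv B * C) (\<tau> k) r"
    and \<pi>: "\<pi> \<noteq> 0" "val \<pi> = Fin q" "0 < q"
    and W: "\<And>i j. i < d \<Longrightarrow> j < d \<Longrightarrow> (mat_inv B * C) $$ (i, j) \<noteq> 0 \<Longrightarrow>
      \<exists>n. val ((mat_inv B * C) $$ (i, j)) = Fin n \<and> \<bar>n\<bar> \<le> W"
  shows "is_pivot val (mat_inv B * C * mat_diag d (\<lambda>j. \<pi> powi (int (Hilbert_Choice.inv \<tau> j) * (2 * W + 1)))) ps (r, \<tau> k)"
proof -
  note D = elim_stateD[OF st]
  define N where "N = mat_inv B * C"
  define f where "f j = \<pi> powi (int (Hilbert_Choice.inv \<tau> j) * (2 * W + 1))" for j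
  have N: "N \<in> carrier_mat d d" using D(6) by (simp add: N_def)
  have f: "f j \<noteq> 0" for j using \<pi>(1) by (simp add: f_def)
  have c: "\<tau> k < d" using permutes_in_image[OF \<tau>, of k] k by simp
  have inv: "Hilbert_Choice.inv \<tau> (\<tau> m) = m" for m using permutes_inverses(2)[OF \<tau>] .
  have rd: "r < d" and nz: "N $$ (r, \<tau> k) \<noteq> 0"
    and min: "\<And>i. i < d \<Longrightarrow> val (N $$ (r, \<tau> k)) < val (N $$ (i, \<tau> k)) \<or>
        val (N $$ (r, \<tau> k)) = val (N $$ (i, \<tau> k)) \<and> r \<le> i"
    using r N by (auto simp: col_pivot_def simp flip: N_def)
  have snd_set: "snd ` set ps = \<tau> ` {..<k}"
    using snd by (metis atLeast_upt set_map)
  have "\<tau> k \<notin> snd ` set ps"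
    unfolding snd_set using inj_image_mem_iff[OF permutes_inj[OF \<tau>], of k "{..<k}"] by simp
  then have fresh: "(r, \<tau> k) \<notin> set ps" by force
  have pos: "val (N $$ (r, \<tau> k) * f (\<tau> k)) < val (N $$ (i, j) * f j) \<or>
      val (N $$ (r, \<tau> k) * f (\<tau> k)) = val (N $$ (i, j) * f j) \<and> (\<tau> k < j \<or> \<tau> k = j \<and> r \<le> i)"
    if ij: "i < d" "j < d" "(i, j) \<notin> set ps" for i j
  proof -
    obtain n where n: "val (N $$ (r, \<tau> k)) = Fin n" "\<bar>n\<bar> \<le> W"
      using W[OF rd c] nz by (auto simp: N_def)
    have vf: "val (f j) = Fin (int (Hilbert_Choice.inv \<tau> j) * (2 * W + 1) * q)" for j
      unfolding f_def by (rule val_power_int[OF \<pi>(1,2)])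
    define m where "m = Hilbert_Choice.inv \<tau> j"
    have m: "j = \<tau> m" "m < d"
      using permutes_inverses(1)[OF \<tau>] permutes_in_image[OF permutes_inv[OF \<tau>], of j] ij(2)
      by (auto simp: m_def)
    \<comment> \<open>A column \<open>\<tau> m\<close> with \<open>m < k\<close> carries an earlier
      pivot and is zero elsewhere, so only the current column and later ones compete.\<close>
    consider (zero) "N $$ (i, j) = 0" | (eq) "m = k" | (gt) "N $$ (i, j) \<noteq> 0" "k < m"
    proof (cases "m < k")
      case True
      then have "j \<in> snd ` set ps" using m snd_set by auto
      then obtain r' where "(r', j) \<in> set ps" by force
      with ij(3) clearedD(4)[OF D(8) this ij(1)] have "N $$ (i, j) = 0"
        by (auto simp: N_def)
      then show ?thesis by (rule that)
    qed (use that in force)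
    then show ?thesis
    proof cases
      case zero
      then show ?thesis by (simp add: n vf val_mult)
    next
      case eq
      then show ?thesis using min[OF ij(1)] m f by (auto simp: val_mult_less_iff val_mult_eq_iff)
    next
      case gt
      obtain n' where n': "val (N $$ (i, j)) = Fin n'" "\<bar>n'\<bar> \<le> W"
        using W[OF ij(1,2)] gt(1) by (auto simp: N_def)
      have "W \<ge> 0" using n by simp
      \<comment> \<open>The scaling separates the two columns by at least \<open>2 * W + 1\<close>,
        while \<open>n\<close> and \<open>n'\<close> differ by at most \<open>2 * W\<close>. The
        factors 1 match the shape of \<open>mult_mono\<close>.\<close>
      have "1 * (2 * W + 1) * 1 \<le> (int m - int k) * (2 * W + 1) * q"
        using gt(2) \<pi>(3) \<open>W \<ge> 0\<close> by (intro mult_mono) auto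
      then have "n + int k * (2 * W + 1) * q < n' + int m * (2 * W + 1) * q"
        using n n' by (simp add: left_diff_distrib)
      then show ?thesis by (simp add: val_mult vf n n' inv flip: m_def)
    qed
  qed
  have "is_pivot val (N * mat_diag d f) ps (r, \<tau> k)"
    using rd c fresh pos by (auto simp: is_pivot_def mat_diag_mult_right[OF N])
  then show ?thesis by (simp add: N_def f_def[abs_def])
qed

lemma prescribed_pivot_columns:
  assumes M: "M \<in> carrier_mat d d" "invertible_mat M" "A \<in> carrier_mat d d" "invertible_mat A"
    and d: "1 \<le> d" and \<pi>: "uniformizer val \<pi>" and \<tau>: "\<tau> permutes {..<d}"
  obtains a where "map snd (sa_pivots val M (A * mat_diag d (\<lambda>j. \<pi> powi a j))) = map \<tau> [0..<d]"
proof -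
  have \<pi>': "\<pi> \<noteq> 0" "0 < val \<pi>" using \<pi> by (auto simp: uniformizer_def)
  obtain q where q: "val \<pi> = Fin q" using \<pi>'(1) by (rule val_FinE)
  with \<pi>'(2) have "0 < q" by (simp add: zero_extended_def)
  define N where "N k = (case forced_run \<tau> M A k of (B, C, ps) \<Rightarrow> mat_inv B * C)" for k
  \<comment> \<open>One bound for the entries of all intermediate matrices, since the same exponents
    have to work in every step. The forced run does not refer to exponents, so there is no
    circularity.\<close>
  obtain W where W: "\<And>x. x \<in> (\<lambda>(k, i, j). N k $$ (i, j)) ` ({..<d} \<times> {..<d} \<times> {..<d}) \<Longrightarrow> x \<noteq> 0 \<Longrightarrow>
      \<exists>n. val x = Fin n \<and> \<bar>n\<bar> \<le> W"
    by (rule finite_val_bound[of "(\<lambda>(k, i, j). N k $$ (i, j)) ` ({..<d} \<times> {..<d} \<times> {..<d})"]) auto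
  define f where "f = (\<lambda>j. \<pi> powi (int (Hilbert_Choice.inv \<tau> j) * (2 * W + 1)))"
  have f: "f j \<noteq> 0" for j using \<pi>'(1) by (simp add: f_def)
  have run: "sa_run val k M (A * mat_diag d f) =
      (case forced_run \<tau> M A k of (B, C, ps) \<Rightarrow> (B, C * mat_diag d f, ps))" if "k < d" for k
    using that
  proof (induction k)
    case 0
    then show ?case by simp
  next
    case (Suc k)
    obtain B C ps where fr: "forced_run \<tau> M A k = (B, C, ps)" by (metis prod_cases3)
    have st: "elim_state d (B, C, ps)" and snd: "map snd ps = map \<tau> [0..<k]"
      using forced_run_state[OF M \<tau> _ fr] Suc.prems by auto
    note D = elim_stateD[OF st]
    have c: "\<tau> k < d" using permutes_in_image[OF \<tau>, of k] Suc.prems by simp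
    define r where "r = (SOME r. col_pivot (mat_inv B * C) (\<tau> k) r)"
    have r: "col_pivot (mat_inv B * C) (\<tau> k) r"
      unfolding r_def using forced_col_pivot[OF st c] .
    have rd: "r < d" using r D(5) by (simp add: col_pivot_def)
    have "\<exists>n. val ((mat_inv B * C) $$ (i, j)) = Fin n \<and> \<bar>n\<bar> \<le> W"
      if "i < d" "j < d" "(mat_inv B * C) $$ (i, j) \<noteq> 0" for i j
    proof (rule W)
      have "(mat_inv B * C) $$ (i, j) = (\<lambda>(k, i, j). N k $$ (i, j)) (k, i, j)"
        by (simp add: N_def fr)
      then show "(mat_inv B * C) $$ (i, j) \<in> (\<lambda>(k, i, j). N k $$ (i, j)) ` ({..<d} \<times> {..<d} \<times> {..<d})"
        using that Suc.prems by (intro image_eqI[of _ _ "(k, i, j)"]) auto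
    qed (rule that(3))
    then have "is_pivot val (mat_inv B * C * mat_diag d f) ps (r, \<tau> k)"
      unfolding f_def using Suc.prems \<pi>'(1) q \<open>0 < q\<close>
      by (intro forced_is_pivot[OF st snd \<tau> _ r]) auto
    moreover have "mat_inv B * C * mat_diag d f = mat_inv B * (C * mat_diag d f)"
      using D by (intro mult_mat_diag_assoc[symmetric])
    ultimately have "sa_pivot val (mat_inv B * (C * mat_diag d f)) ps = (r, \<tau> k)"
      by (simp add: sa_pivot_eq)
    then have "sa_run val (Suc k) M (A * mat_diag d f) = elim_step (r, \<tau> k) (B, C * mat_diag d f, ps)"
      using Suc fr by (simp add: sa_run_Suc sa_step_eq)
    also have "\<dots> = (case elim_step (r, \<tau> k) (B, C, ps) of (B', C', ps') \<Rightarrow> (B', C' * mat_diag d f, ps'))"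
      using elim_step_mult_diag[OF st rd c] f by blast
    finally show ?case by (simp add: fr r_def)
  qed
  obtain B C ps where fr: "forced_run \<tau> M A (d - 1) = (B, C, ps)" by (metis prod_cases3)
  have snd: "map snd ps = map \<tau> [0..<d - 1]"
    using forced_run_state[OF M \<tau> _ fr] by auto
  have run': "sa_run val (d - 1) M (A * mat_diag d f) = (B, C * mat_diag d f, ps)"
    using run[of "d - 1"] fr d by simp
  have Af: "A * mat_diag d f \<in> carrier_mat d d" "invertible_mat (A * mat_diag d f)"
    using mult_mat_diag_invertible[OF M(3,4)] f by blast+
  obtain r c where rc: "sa_pivots val M (A * mat_diag d f) = ps @ [(r, c)]"
    and cl: "cleared d (mat_inv B * (C * mat_diag d f)) (ps @ [(r, c)])"
    using sa_pivots_snd[OF M(1,2) Af d run'] .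
  \<comment> \<open>The last pivot is not selected by valuation; it lies in the only column left
    over.\<close>
  have "c = \<tau> (d - 1)"
  proof -
    have "c < d" "c \<notin> set (map snd ps)" using cl by (auto simp: cleared_def)
    then have "c \<in> {..<d}" "c \<notin> \<tau> ` {..<d - 1}"
      unfolding snd by (auto simp: atLeast0LessThan)
    then obtain m where m: "c = \<tau> m" "m < d" "\<not> m < d - 1"
      using permutes_image[OF \<tau>] by blast
    from m(2,3) have "m = d - 1" by simp
    with m(1) show ?thesis by simp
  qed
  then have "map snd (sa_pivots val M (A * mat_diag d f)) = map \<tau> ([0..<d - 1] @ [d - 1])"
    unfolding rc using snd by simp
  also have "[0..<d - 1] @ [d - 1] = [0..<d]"
    using upt_Suc_append[of 0 "d - 1"] d by simp
  finally show thesis unfolding f_def by (rule that)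
qed


section \<open>Covering the convex hull\<close>

text \<open>The order \<open>\<tau>\<close> is read off from the run on the scaling of
  \<open>A\<close> that spans \<open>\<Lambda>\<close>. The exponents \<open>a \<tau>\<close>
  produce the same order, hence the same basis.\<close>

lemma sa_basis_cover:
  assumes M: "M \<in> carrier_mat d d" "invertible_mat M" "A \<in> carrier_mat d d" "invertible_mat A"
    and d: "1 \<le> d" and "\<pi> \<noteq> 0" and "adapted d A \<Lambda>"
    and a: "\<And>\<tau>. \<tau> permutes {..<d} \<Longrightarrow>
      map snd (sa_pivots val M (A * mat_diag d (\<lambda>j. \<pi> powi a \<tau> j))) = map \<tau> [0..<d]"
  obtains \<tau> where "\<tau> permutes {..<d}"
    "adapted d (sa_basis val M (A * mat_diag d (\<lambda>j. \<pi> powi a \<tau> j))) (mat_lattice val M)"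
    "adapted d (sa_basis val M (A * mat_diag d (\<lambda>j. \<pi> powi a \<tau> j))) \<Lambda>"
proof -
  obtain f where f: "\<And>i. i < d \<Longrightarrow> f i \<noteq> 0" "\<Lambda> = mat_lattice val (A * mat_diag d f)"
    using assms(7) by (auto simp: adapted_def)
  have Af: "A * mat_diag d f \<in> carrier_mat d d" "invertible_mat (A * mat_diag d f)"
    using mult_mat_diag_invertible[OF M(3,4)] f(1) by blast+
  obtain B C ps where run: "sa_run val (d - 1) M (A * mat_diag d f) = (B, C, ps)"
    by (metis prod_cases3)
  have "length ps = d - 1" using sa_run_state[OF M(1,2) Af _ run] by simp
  moreover obtain r c where rc: "sa_pivots val M (A * mat_diag d f) = ps @ [(r, c)]"
    "cleared d (mat_inv B * C) (ps @ [(r, c)])"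
    using sa_pivots_snd[OF M(1,2) Af d run] .
  ultimately obtain \<tau> where \<tau>: "\<tau> permutes {..<d}"
    "map snd (sa_pivots val M (A * mat_diag d f)) = map \<tau> [0..<d]"
    using pivot_columns_permutes[OF rc(2)] d by auto
  have "sa_basis val M (A * mat_diag d f) = sa_basis val M (A * mat_diag d (\<lambda>j. \<pi> powi a \<tau> j))"
    using f(1) assms(6) a[OF \<tau>(1)] \<tau>(2) by (intro sa_basis_pivot_columns[OF M d]) auto
  then show thesis
    using sa_basis_adapted(3,4)[OF M(1,2) Af d] \<tau>(1) f(2) by (intro that[of \<tau>]) auto
qed

text \<open>All representatives of the classes in the convex hull of the lattices of \<open>Ms\<close>.\<close>

inductive_set hull_lattices :: "'a mat set \<Rightarrow> 'a vec set set" for Ms where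
  scale: "M \<in> Ms \<Longrightarrow> c \<noteq> 0 \<Longrightarrow> (\<cdot>\<^sub>v) c ` mat_lattice val M \<in> hull_lattices Ms"
| Int: "\<Lambda> \<in> hull_lattices Ms \<Longrightarrow> \<Lambda>' \<in> hull_lattices Ms \<Longrightarrow> \<Lambda> \<inter> \<Lambda>' \<in> hull_lattices Ms"

lemma smult_smult_image: "(\<cdot>\<^sub>v) a ` (\<cdot>\<^sub>v) b ` \<Lambda> = (\<cdot>\<^sub>v) (a * b) ` (\<Lambda> :: 'a vec set)"
  by (simp add: image_image smult_smult_assoc)

text \<open>Scaling is injective and therefore commutes with intersections.\<close>

lemma hull_lattices_smult:
  "\<Lambda> \<in> hull_lattices Ms \<Longrightarrow> c \<noteq> 0 \<Longrightarrow> (\<cdot>\<^sub>v) c ` \<Lambda> \<in> hull_lattices Ms"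
proof (induction rule: hull_lattices.induct)
  case (scale M b)
  then show ?case
    using hull_lattices.scale[of M Ms "c * b"] by (simp add: smult_smult_image)
next
  case (Int \<Lambda> \<Lambda>')
  have "inj ((\<cdot>\<^sub>v) c :: 'a vec \<Rightarrow> 'a vec)"
  proof (rule inj_on_inverseI)
    show "inverse c \<cdot>\<^sub>v (c \<cdot>\<^sub>v v) = v" for v :: "'a vec"
      using Int.prems by (simp add: smult_smult_assoc)
  qed
  then show ?case using Int by (simp add: image_Int hull_lattices.Int)
qed

lemma hull_lattices_Inter:
  "finite F \<Longrightarrow> F \<noteq> {} \<Longrightarrow> F \<subseteq> hull_lattices Ms \<Longrightarrow> \<Inter> F \<in> hull_lattices Ms"
  by (induction F rule: finite_ne_induct) (auto intro: hull_lattices.Int)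

text \<open>Valuations are totally ordered, and the scalar of smaller valuation gives the larger
  lattice.\<close>

lemma scaled_lattice_chain:
  assumes "M \<in> carrier_mat d d" "b \<noteq> 0" "c \<noteq> 0"
  shows "(\<cdot>\<^sub>v) b ` mat_lattice val M \<subseteq> (\<cdot>\<^sub>v) c ` mat_lattice val M \<or>
    (\<cdot>\<^sub>v) c ` mat_lattice val M \<subseteq> (\<cdot>\<^sub>v) b ` mat_lattice val M"
proof -
  have *: "(\<cdot>\<^sub>v) c ` mat_lattice val M \<subseteq> (\<cdot>\<^sub>v) b ` mat_lattice val M"
    if "val b \<le> val c" "b \<noteq> 0" for b c
  proof
    fix v assume "v \<in> (\<cdot>\<^sub>v) c ` mat_lattice val M"
    then obtain x where x: "x \<in> integral_vecs d" "v = c \<cdot>\<^sub>v (M *\<^sub>v x)"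
      using assms(1) by (auto simp: mat_lattice_eq_image)
    have "c / b \<in> \<O>" using that by (simp add: val_le_iff_divide)
    from val_ring_mult[OF this] have "(c / b) \<cdot>\<^sub>v x \<in> integral_vecs d"
      using x by (auto simp: integral_vecs_def)
    moreover have "v = b \<cdot>\<^sub>v (M *\<^sub>v ((c / b) \<cdot>\<^sub>v x))"
      using x that assms(1) by (simp add: integral_vecs_def mult_mat_vec[of _ d d] smult_smult_assoc)
    ultimately show "v \<in> (\<cdot>\<^sub>v) b ` mat_lattice val M"
      using assms(1) by (simp add: mat_lattice_eq_image)
  qed
  show ?thesis using *[of b c] *[of c b] assms(2,3) by (meson linear)
qed

text \<open>The three shapes together are closed under intersection: of two multiples of the new
  lattice the smaller one remains, and the old parts merge within
  \<open>hull_lattices Ms\<close>.\<close>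

lemma hull_lattices_insert:
  assumes "\<Lambda> \<in> hull_lattices (insert M Ms)" "M \<in> carrier_mat d d"
  shows "\<Lambda> \<in> hull_lattices Ms \<or> (\<exists>c. c \<noteq> 0 \<and> \<Lambda> = (\<cdot>\<^sub>v) c ` mat_lattice val M) \<or>
    (\<exists>c \<Lambda>'. c \<noteq> 0 \<and> \<Lambda>' \<in> hull_lattices Ms \<and> \<Lambda> = (\<cdot>\<^sub>v) c ` mat_lattice val M \<inter> \<Lambda>')"
  using assms(1)
proof induction
  case (scale M' c)
  then show ?case using hull_lattices.scale[of M' Ms c] by blast
next
  case (Int \<Lambda>1 \<Lambda>2)
  define S where "S = {(\<cdot>\<^sub>v) c ` mat_lattice val M | c. c \<noteq> 0}"
  define H where "H = hull_lattices Ms"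
  have S: "X \<inter> Y \<in> S" if X: "X \<in> S" and Y: "Y \<in> S" for X Y
  proof -
    obtain b c where "b \<noteq> 0" "c \<noteq> 0" "X = (\<cdot>\<^sub>v) b ` mat_lattice val M" "Y = (\<cdot>\<^sub>v) c ` mat_lattice val M"
      using X Y by (auto simp: S_def)
    then have "X \<subseteq> Y \<or> Y \<subseteq> X"
      using scaled_lattice_chain[OF assms(2)] by simp
    with X Y show ?thesis by (metis inf.absorb1 inf.absorb2)
  qed
  have H: "X \<inter> Y \<in> H" if "X \<in> H" "Y \<in> H" for X Y
    using that unfolding H_def by (rule hull_lattices.Int)
  define D where "D \<Lambda> \<longleftrightarrow> \<Lambda> \<in> H \<or> \<Lambda> \<in> S \<or> (\<exists>X\<in>S. \<exists>Y\<in>H. \<Lambda> = X \<inter> Y)" for \<Lambda>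
  have D: "D (X \<inter> Y)" if "X \<in> S" "Y \<in> H" for X Y
    using that by (auto simp: D_def)
  have DH: "D (\<Lambda> \<inter> Y)" if "D \<Lambda>" "Y \<in> H" for \<Lambda> Y
    using that(1) unfolding D_def[of \<Lambda>]
  proof (elim disjE bexE)
    fix X Z assume "X \<in> S" "Z \<in> H" "\<Lambda> = X \<inter> Z"
    then show ?thesis using D[of X "Z \<inter> Y"] H that(2) by (simp add: Int_assoc D_def)
  qed (use that(2) H D in \<open>auto simp: D_def\<close>)
  have DS: "D (X \<inter> \<Lambda>)" if "D \<Lambda>" "X \<in> S" for \<Lambda> X
    using that(1) unfolding D_def[of \<Lambda>]
  proof (elim disjE bexE)
    fix W Z assume "W \<in> S" "Z \<in> H" "\<Lambda> = W \<inter> Z"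
    then show ?thesis using D[of "X \<inter> W" Z] S that(2) by (simp add: Int_assoc D_def)
  qed (use that(2) S D in \<open>auto simp: D_def\<close>)
  have "D \<Lambda>1" "D \<Lambda>2"
    using Int.IH by (auto simp: D_def S_def H_def)
  \<comment> \<open>It suffices to split \<open>\<Lambda>1\<close>: its factors are absorbed one at
    a time by \<open>DH\<close> and \<open>DS\<close>.\<close>
  have "D (\<Lambda>2 \<inter> \<Lambda>1)"
    using \<open>D \<Lambda>1\<close> unfolding D_def[of \<Lambda>1]
  proof (elim disjE bexE)
    fix X Y assume "X \<in> S" "Y \<in> H" "\<Lambda>1 = X \<inter> Y"
    then show ?thesis
      using DS[OF DH[OF \<open>D \<Lambda>2\<close>], of Y X] by (simp add: Int_ac)
  next
    assume "\<Lambda>1 \<in> S"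
    then show ?thesis using DS[OF \<open>D \<Lambda>2\<close>] by (simp add: Int_commute)
  qed (rule DH[OF \<open>D \<Lambda>2\<close>])
  then have "D (\<Lambda>1 \<inter> \<Lambda>2)" by (simp only: Int_commute)
  then show ?case unfolding D_def S_def H_def by blast
qed


lemma homothety_class_smult:
  assumes "c \<noteq> 0"
  shows "homothety_class ((\<cdot>\<^sub>v) c ` \<Lambda>) = homothety_class (\<Lambda> :: 'a vec set)"
proof -
  have *: "homothety_class ((\<cdot>\<^sub>v) c ` \<Lambda>) \<subseteq> homothety_class \<Lambda>" if "c \<noteq> 0" for c and \<Lambda> :: "'a vec set"
    using that unfolding homothety_class_def
    by (clarsimp simp: smult_smult_image) (metis mult_eq_0_iff)
  \<comment> \<open>The reverse inclusion is the one above for the scalar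
    \<open>1 / c\<close>.\<close>
  have "(\<cdot>\<^sub>v) (1 / c) ` (\<cdot>\<^sub>v) c ` \<Lambda> = \<Lambda>"
    using assms by (simp add: smult_smult_image)
  then show ?thesis using *[of c \<Lambda>] *[of "1 / c" "(\<cdot>\<^sub>v) c ` \<Lambda>"] assms by auto
qed

lemma adapted_smult_iff:
  assumes "A \<in> carrier_mat d d" "invertible_mat A" "uniformizer val \<pi>" "c \<noteq> 0"
  shows "adapted d A ((\<cdot>\<^sub>v) c ` \<Lambda>) \<longleftrightarrow> adapted d A \<Lambda>"
  using assms(4) by (simp add: adapted_iff_apartment[OF assms(1-3)] homothety_class_smult)

section \<open>Existence, size and covering property of the apartment list\<close>

context
  fixes \<pi> :: 'a and d :: nat
  assumes \<pi>: "uniformizer val \<pi>" and d: "1 \<le> d"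
begin

lemma uniformizer_nonzero: "\<pi> \<noteq> 0"
  using \<pi> by (simp add: uniformizer_def)

lemma mult_powi_diag_invertible:
  assumes "A \<in> carrier_mat d d" "invertible_mat A"
  shows "A * mat_diag d (\<lambda>j. \<pi> powi u j) \<in> carrier_mat d d"
    "invertible_mat (A * mat_diag d (\<lambda>j. \<pi> powi u j))"
  using mult_mat_diag_invertible[OF assms, of "\<lambda>j. \<pi> powi u j"] uniformizer_nonzero by auto

text \<open>Each permutation has a suitable exponent vector by
  \<open>prescribed_pivot_columns\<close>; choice collects them into one function
  \<open>a\<close>.\<close>

lemma refines_exists:
  assumes "M \<in> carrier_mat d d" "invertible_mat M" "A \<in> carrier_mat d d" "invertible_mat A"
  obtains LA where "refines val \<pi> d M (apartment val \<pi> A) LA"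
proof -
  have "\<forall>\<tau>. \<exists>a. \<tau> permutes {..<d} \<longrightarrow>
      map snd (sa_pivots val M (A * mat_diag d (\<lambda>j. \<pi> powi a j))) = map \<tau> [0..<d]"
    using prescribed_pivot_columns[OF assms d \<pi>] by metis
  then obtain a where "\<And>\<tau>. \<tau> permutes {..<d} \<Longrightarrow>
      map snd (sa_pivots val M (A * mat_diag d (\<lambda>j. \<pi> powi a \<tau> j))) = map \<tau> [0..<d]"
    by metis
  then have "refines val \<pi> d M (apartment val \<pi> A)
      {apartment val \<pi> (sa_basis val M (A * mat_diag d (\<lambda>j. \<pi> powi a \<tau> j))) | \<tau>. \<tau> permutes {..<d}}"
    unfolding refines_def using assms(3,4) by (intro exI[of _ A] exI[of _ a] conjI) auto
  then show thesis by (rule that)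
qed

lemma refines_apartment:
  assumes "refines val \<pi> d M ap LA" "ap' \<in> LA" "M \<in> carrier_mat d d" "invertible_mat M"
  obtains B where "B \<in> carrier_mat d d" "invertible_mat B" "ap' = apartment val \<pi> B"
proof -
  obtain A a \<tau> where "A \<in> carrier_mat d d" "invertible_mat A"
    "ap' = apartment val \<pi> (sa_basis val M (A * mat_diag d (\<lambda>j. \<pi> powi a \<tau> j)))"
    using assms(1,2) by (auto simp: refines_def)
  then show thesis
    using sa_basis_adapted(1,2)[OF assms(3,4) mult_powi_diag_invertible d] by (intro that) auto
qed

lemma refines_card:
  assumes "refines val \<pi> d M ap LA"
  shows "finite LA" "card LA \<le> fact d"
proof -
  obtain A a where LA: "LA = (\<lambda>\<tau>. apartment val \<pi> (sa_basis val M (A * mat_diag d (\<lambda>j. \<pi> powi a \<tau> j))))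
      ` {\<tau>. \<tau> permutes {..<d}}"
    using assms by (auto simp: refines_def)
  have fin: "finite {\<tau>. \<tau> permutes {..<d}}" by (rule finite_permutations) simp
  show "finite LA" using fin by (simp add: LA)
  have "card LA \<le> card {\<tau>. \<tau> permutes {..<d}}" unfolding LA by (rule card_image_le[OF fin])
  also have "\<dots> = fact d" by (rule card_permutations) auto
  finally show "card LA \<le> fact d" .
qed

text \<open>The representative \<open>A\<close> that \<open>refines\<close> supplies may differ from
  the matrix that produced \<open>ap\<close>; adaptedness reaches it through the apartment.\<close>

lemma refines_cover:
  assumes "refines val \<pi> d M ap LA" "homothety_class \<Lambda> \<in> ap" "M \<in> carrier_mat d d" "invertible_mat M"
  obtains B where "B \<in> carrier_mat d d" "invertible_mat B" "apartment val \<pi> B \<in> LA"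
    "adapted d B (mat_lattice val M)" "adapted d B \<Lambda>"
proof -
  obtain A a where A: "A \<in> carrier_mat d d" "invertible_mat A" "apartment val \<pi> A = ap"
    and a: "\<And>\<tau>. \<tau> permutes {..<d} \<Longrightarrow>
      map snd (sa_pivots val M (A * mat_diag d (\<lambda>j. \<pi> powi a \<tau> j))) = map \<tau> [0..<d]"
    and LA: "LA = {apartment val \<pi> (sa_basis val M (A * mat_diag d (\<lambda>j. \<pi> powi a \<tau> j)))
              | \<tau>. \<tau> permutes {..<d}}"
    using assms(1) unfolding refines_def by blast
  have "adapted d A \<Lambda>"
    using adapted_iff_apartment[OF A(1,2) \<pi>] A(3) assms(2) by simp
  obtain \<tau> where \<tau>: "\<tau> permutes {..<d}"
    "adapted d (sa_basis val M (A * mat_diag d (\<lambda>j. \<pi> powi a \<tau> j))) (mat_lattice val M)"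
    "adapted d (sa_basis val M (A * mat_diag d (\<lambda>j. \<pi> powi a \<tau> j))) \<Lambda>"
    using sa_basis_cover[OF assms(3,4) A(1,2) d uniformizer_nonzero \<open>adapted d A \<Lambda>\<close> a] by blast
  show thesis
    using sa_basis_adapted(1,2)[OF assms(3,4) mult_powi_diag_invertible[OF A(1,2)] d] \<tau>
    by (intro that[of "sa_basis val M (A * mat_diag d (\<lambda>j. \<pi> powi a \<tau> j))"]) (auto simp: LA)
qed

text \<open>Nonemptiness serves the lattices that are multiples of the newest one alone, for which
  any earlier apartment can be refined. The representing matrices are what
  \<open>refines_exists\<close> and \<open>adapted_iff_apartment\<close> apply to.\<close>

lemma apartment_list_apartment:
  assumes "apartment_list val \<pi> d Ms L" "\<And>M. M \<in> set Ms \<Longrightarrow> M \<in> carrier_mat d d \<and> invertible_mat M"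
  shows "L \<noteq> {} \<and> (\<forall>ap \<in> L. \<exists>B. B \<in> carrier_mat d d \<and> invertible_mat B \<and> ap = apartment val \<pi> B)"
  using assms
proof induction
  case (two M1 M2)
  then show ?case
    using sa_basis_adapted(1,2)[OF _ _ _ _ d, of M1 M2] by auto
next
  case (more Ms L M LA)
  have M: "M \<in> carrier_mat d d" "invertible_mat M" using more.prems by auto
  have "L \<noteq> {}" using more.IH more.prems by simp
  moreover have "LA ap \<noteq> {}" if ap: "ap \<in> L" for ap
  proof -
    obtain A a where "LA ap = {apartment val \<pi> (sa_basis val M (A * mat_diag d (\<lambda>j. \<pi> powi a \<tau> j)))
              | \<tau>. \<tau> permutes {..<d}}"
      using more.hyps(2)[OF ap] unfolding refines_def by blast
    then show ?thesis by (auto intro: exI[of _ id])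
  qed
  moreover have "\<exists>B. B \<in> carrier_mat d d \<and> invertible_mat B \<and> ap' = apartment val \<pi> B"
    if "ap \<in> L" "ap' \<in> LA ap" for ap ap'
    using refines_apartment[OF more.hyps(2)[OF that(1)] that(2) M] by blast
  ultimately show ?case by auto
qed

text \<open>Each apartment of the shorter list contributes at most \<open>d!\<close> new ones. The
  bound \<open>2 \<le> length Ms\<close> is carried along because the exponent is a truncated
  difference.\<close>

lemma apartment_list_card:
  "apartment_list val \<pi> d Ms L \<Longrightarrow>
    2 \<le> length Ms \<and> finite L \<and> card L \<le> fact d ^ (length Ms - 2)"
proof (induction rule: apartment_list.induct)
  case (more Ms L M LA)
  have "card (\<Union>ap\<in>L. LA ap) \<le> (\<Sum>ap\<in>L. card (LA ap))"
    using more.IH by (intro card_UN_le) simp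
  also have "\<dots> \<le> card L * fact d"
    using sum_mono[of L "\<lambda>ap. card (LA ap)" "\<lambda>_. fact d"] refines_card(2)[OF more.hyps(2)] by simp
  also have "\<dots> \<le> fact d ^ (length Ms - 2) * fact d"
    using more.IH by (intro mult_right_mono) auto
  also have "\<dots> = fact d ^ (length (M # Ms) - 2)"
  proof -
    have "length (M # Ms) - 2 = Suc (length Ms - 2)" using more.IH by auto
    then show ?thesis by (simp only: power_Suc2)
  qed
  finally show ?case
    using more.IH refines_card(1)[OF more.hyps(2)] by simp
qed simp

lemma apartment_list_cover:
  assumes "apartment_list val \<pi> d Ms L" "\<And>M. M \<in> set Ms \<Longrightarrow> M \<in> carrier_mat d d \<and> invertible_mat M"
    and "\<Lambda> \<in> hull_lattices (set Ms)"
  shows "\<exists>ap \<in> L. homothety_class \<Lambda> \<in> ap"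
  using assms
proof (induction arbitrary: \<Lambda>)
  case (two M1 M2)
  have M: "M1 \<in> carrier_mat d d" "invertible_mat M1" "M2 \<in> carrier_mat d d" "invertible_mat M2"
    using two.prems by auto
  note B = sa_basis_adapted[OF M d]
  have "adapted d (sa_basis val M1 M2) \<Lambda>"
    using two.prems(2)
  proof (induction \<Lambda>)
    case (scale M c)
    then show ?case using B(3,4) adapted_smult_iff[OF B(1,2) \<pi>] by auto
  qed (rule adapted_Int[OF B(1,2)])
  then show ?case using adapted_iff_apartment[OF B(1,2) \<pi>] by simp
next
  case (more Ms L M LA)
  have M: "M \<in> carrier_mat d d" "invertible_mat M"
    and Ms: "\<And>M. M \<in> set Ms \<Longrightarrow> M \<in> carrier_mat d d \<and> invertible_mat M"
    using more.prems by auto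
  \<comment> \<open>A lattice covered by the shorter list acquires a basis to which the new lattice
    is adapted as well.\<close>
  have covered: "\<exists>ap \<in> L. \<exists>B. B \<in> carrier_mat d d \<and> invertible_mat B \<and> apartment val \<pi> B \<in> LA ap \<and>
      adapted d B (mat_lattice val M) \<and> adapted d B \<Lambda>'" if "\<exists>ap \<in> L. homothety_class \<Lambda>' \<in> ap" for \<Lambda>'
  proof -
    obtain ap where ap: "ap \<in> L" "homothety_class \<Lambda>' \<in> ap" using \<open>\<exists>ap \<in> L. homothety_class \<Lambda>' \<in> ap\<close> ..
    show ?thesis using refines_cover[OF more.hyps(2)[OF ap(1)] ap(2) M] ap(1) by metis
  qed
  have finish: ?case
    if ap: "ap \<in> L" and B: "B \<in> carrier_mat d d" "invertible_mat B" "apartment val \<pi> B \<in> LA ap"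
      and "adapted d B \<Lambda>" for ap B
    using that adapted_iff_apartment[OF B(1,2) \<pi>] by blast
  have "\<Lambda> \<in> hull_lattices (insert M (set Ms))" using more.prems(2) by simp
  from hull_lattices_insert[OF this M(1)] consider
    (old) "\<Lambda> \<in> hull_lattices (set Ms)"
    | (new) c where "c \<noteq> 0" "\<Lambda> = (\<cdot>\<^sub>v) c ` mat_lattice val M"
    | (both) c \<Lambda>' where "c \<noteq> 0" "\<Lambda>' \<in> hull_lattices (set Ms)"
        "\<Lambda> = (\<cdot>\<^sub>v) c ` mat_lattice val M \<inter> \<Lambda>'"
    by blast
  then show ?case
  proof cases
    case old
    from covered[OF more.IH[OF Ms this]] show ?thesis using finish by blast
  next
    case new
    \<comment> \<open>No old lattice is involved here, so the lattice of an arbitrary earlier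
      apartment takes its place.\<close>
    obtain ap A where "ap \<in> L" "A \<in> carrier_mat d d" "invertible_mat A" "ap = apartment val \<pi> A"
      using apartment_list_apartment[OF more.hyps(1) Ms] by blast
    then have "\<exists>ap \<in> L. homothety_class (mat_lattice val A) \<in> ap"
      using adapted_iff_apartment[OF _ _ \<pi>, of A d] adapted_self by blast
    from covered[OF this] obtain ap B where B: "ap \<in> L" "B \<in> carrier_mat d d" "invertible_mat B"
      "apartment val \<pi> B \<in> LA ap" "adapted d B (mat_lattice val M)" by blast
    then show ?thesis
      using adapted_smult_iff[OF B(2,3) \<pi> new(1)] new(2) by (intro finish) auto
  next
    case both
    from covered[OF more.IH[OF Ms both(2)]]
    obtain ap B where B: "ap \<in> L" "B \<in> carrier_mat d d" "invertible_mat B"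
      "apartment val \<pi> B \<in> LA ap" "adapted d B (mat_lattice val M)" "adapted d B \<Lambda>'" by blast
    then have "adapted d B \<Lambda>"
      using adapted_smult_iff[OF B(2,3) \<pi> both(1)] adapted_Int[OF B(2,3)] both(3) by blast
    with B show ?thesis by (intro finish)
  qed
qed

lemma apartment_list_exists:
  assumes "2 \<le> length Ms" "\<And>M. M \<in> set Ms \<Longrightarrow> M \<in> carrier_mat d d \<and> invertible_mat M"
  shows "\<exists>L. apartment_list val \<pi> d Ms L"
  using assms
proof (induction Ms)
  case (Cons M Ms)
  show ?case
  proof (cases "2 \<le> length Ms")
    case True
    with Cons obtain L where L: "apartment_list val \<pi> d Ms L" by auto
    have "\<exists>LA. refines val \<pi> d M ap LA" if ap: "ap \<in> L" for ap
    proof -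
      have "\<And>M. M \<in> set Ms \<Longrightarrow> M \<in> carrier_mat d d \<and> invertible_mat M"
        using Cons.prems(2) by simp
      note B = bspec[OF conjunct2[OF apartment_list_apartment[OF L this]] ap]
      obtain A where "A \<in> carrier_mat d d" "invertible_mat A" "ap = apartment val \<pi> A"
        using B by blast
      then show ?thesis
        using refines_exists[of M A] Cons.prems(2)[of M] by auto
    qed
    then obtain LA where "\<And>ap. ap \<in> L \<Longrightarrow> refines val \<pi> d M ap (LA ap)" by metis
    from apartment_list.more[OF L this] show ?thesis by blast
  next
    case False
    with Cons.prems(1) have "length Ms = 1" by simp
    then obtain M2 where "Ms = [M2]" by (auto simp: length_Suc_conv)
    then show ?thesis using apartment_list.two by blast
  qed
qed simp

lemma lattice_convex_hull:
  assumes "\<And>\<Lambda>. \<Lambda> \<in> hull_lattices Ms \<Longrightarrow> is_lattice val d \<Lambda>"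
  shows "lattice_convex val d (homothety_class ` hull_lattices Ms)"
  unfolding lattice_convex_def
proof (intro conjI allI impI)
  show "homothety_class ` hull_lattices Ms \<subseteq> building_vertices val d"
    using assms by (auto simp: building_vertices_def)
  fix F assume F: "finite F" "F \<noteq> {}" "F \<subseteq> \<Union> (homothety_class ` hull_lattices Ms)"
  \<comment> \<open>Representatives of these classes are multiples of members of the hull and hence
    members themselves.\<close>
  have "F \<subseteq> hull_lattices Ms"
    using F(3) hull_lattices_smult by (fastforce simp: homothety_class_def)
  with F show "homothety_class (\<Inter> F) \<in> homothety_class ` hull_lattices Ms"
    by (intro imageI hull_lattices_Inter)
qed

lemma mat_lattice_in_hull_lattices:
  assumes "M \<in> Ms"
  shows "mat_lattice val M \<in> hull_lattices Ms"
  using hull_lattices.scale[OF assms, of 1] by simp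

text \<open>The convex hull is the intersection of all convex sets containing the generators, and
  the classes of \<open>hull_lattices\<close> form one such set.\<close>

lemma apartment_list_conv:
  assumes L: "apartment_list val \<pi> d Ms L"
    and Ms: "\<And>M. M \<in> set Ms \<Longrightarrow> M \<in> carrier_mat d d \<and> invertible_mat M"
    and "x \<in> lattice_conv val d ((\<lambda>M. homothety_class (mat_lattice val M)) ` set Ms)"
  shows "\<exists>ap \<in> L. x \<in> ap"
proof -
  have "is_lattice val d \<Lambda>" if \<Lambda>: "\<Lambda> \<in> hull_lattices (set Ms)" for \<Lambda>
  proof -
    obtain ap where ap: "ap \<in> L" "homothety_class \<Lambda> \<in> ap"
      using apartment_list_cover[OF L Ms \<Lambda>] by blast
    obtain B where B: "B \<in> carrier_mat d d" "invertible_mat B" "ap = apartment val \<pi> B"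
      using apartment_list_apartment[OF L Ms] ap(1) by blast
    then show ?thesis
      using ap(2) adapted_iff_apartment[OF B(1,2) \<pi>] by (auto intro: adapted_is_lattice)
  qed
  then have "lattice_convex val d (homothety_class ` hull_lattices (set Ms))"
    by (rule lattice_convex_hull)
  moreover have "(\<lambda>M. homothety_class (mat_lattice val M)) ` set Ms \<subseteq>
      homothety_class ` hull_lattices (set Ms)"
    using mat_lattice_in_hull_lattices by auto
  ultimately have "x \<in> homothety_class ` hull_lattices (set Ms)"
    using assms(3) unfolding lattice_conv_def by blast
  then show ?thesis using apartment_list_cover[OF L Ms] by blast
qed

end

end

text \<open>As \<open>apartment_list\<close> is a relation, the existence of an output accompanies
  the properties of every output, which could otherwise hold vacuously.\<close>

theorem theorem4p2:
  fixes val :: "'a :: field \<Rightarrow> int extended" and \<pi> :: 'a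
    and d :: nat and Ms :: "'a mat list"
  assumes "discrete_valuation val" and "uniformizer val \<pi>"
    and "1 \<le> d"
    and "2 \<le> length Ms"
    and "\<And>M. M \<in> set Ms \<Longrightarrow> M \<in> carrier_mat d d \<and> invertible_mat M"
  shows "(\<exists>L. apartment_list val \<pi> d Ms L) \<and>
    (\<forall>L. apartment_list val \<pi> d Ms L \<longrightarrow>
       (\<forall>x \<in> lattice_conv val d ((\<lambda>M. homothety_class (mat_lattice val M)) ` set Ms).
          \<exists>ap \<in> L. x \<in> ap) \<and>
       finite L \<and> card L \<le> fact d ^ (length Ms - 2))"
proof -
  interpret discrete_valuation val by fact
  note prems = assms(2,3)
  show ?thesis
    using apartment_list_exists[OF prems assms(4,5)] apartment_list_conv[OF prems _ assms(5)]
      apartment_list_card[OF prems] by blast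
qed

end
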